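(* Let $1\leq p\leq\infty$. Any quasinilpotent weighted bilateral shift $T_{w,p}$ is cyclic. In particular, any compact weighted bilateral shift $T_{w,p}$ is cyclic.
   Context: All vector spaces are over $\mathbb{C}$; $\mathbb{Z}_+$ is the set of non-negative integers. For a bounded sequence $w=\{w_n\}_{n\in\mathbb{Z}}$ of non-zero complex numbers, the weighted bilateral shift $T_{w,p}$ is the bounded linear operator acting on $\ell_p(\mathbb{Z})$ if $1\leq p<\infty$, and on $c_0(\mathbb{Z})$ if $p=\infty$, defined on the canonical basis by $T_{w,p}e_n=w_ne_{n-1}$ for $n\in\mathbb{Z}$. A bounded linear operator $T$ on a Banach space $\mathcal{B}$ is cyclic if there is $x\in\mathcal{B}$ such that the linear span of $\{T^nx:n\in\mathbb{Z}_+\}$ is dense in $\mathcal{B}$; it is quasinilpotent if its spectrum is $\{0\}$, equivalently $\|T^n\|^{1/n}\to0$. *)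

theory Defs
  imports "HOL-Analysis.Analysis" "HOL-Library.Function_Algebras"
begin

section \<open>Two-sided complex sequences as a vector space\<close>

definition cscale :: "complex \<Rightarrow> (int \<Rightarrow> complex) \<Rightarrow> int \<Rightarrow> complex" where
  "cscale c x = (\<lambda>n. c * x n)"

interpretation cseq: vector_space cscale
  by unfold_locales (auto simp: cscale_def fun_eq_iff algebra_simps)


section \<open>The Banach spaces\<close>

text \<open>The space is \<open>\<ell>\<^sub>p(\<int>)\<close> for finite \<open>p\<close>, and \<open>c\<^sub>0(\<int>)\<close> for \<open>p = \<infinity>\<close>.\<close>

definition seq_space :: "ereal \<Rightarrow> (int \<Rightarrow> complex) set" where
  "seq_space p =
     (if p = \<infinity> then {x. (x \<longlongrightarrow> 0) cofinite}
      else {x. (\<lambda>n. cmod (x n) powr real_of_ereal p) summable_on UNIV})"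

definition seq_norm :: "ereal \<Rightarrow> (int \<Rightarrow> complex) \<Rightarrow> real" where
  "seq_norm p x =
     (if p = \<infinity> then (SUP n. cmod (x n))
      else (\<Sum>\<^sub>\<infinity>n. cmod (x n) powr real_of_ereal p) powr (1 / real_of_ereal p))"

text \<open>The guard only fixes a value outside the space: \<open>Metric_space\<close> demands
  non-negativity for all arguments, while an unbounded supremum is unspecified.\<close>

definition seq_dist :: "ereal \<Rightarrow> (int \<Rightarrow> complex) \<Rightarrow> (int \<Rightarrow> complex) \<Rightarrow> real" where
  "seq_dist p x y = (if x - y \<in> seq_space p then seq_norm p (x - y) else 0)"

definition seq_top :: "ereal \<Rightarrow> (int \<Rightarrow> complex) topology" where
  "seq_top p = Metric_space.mtopology (seq_space p) (seq_dist p)"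


section \<open>Operators\<close>

text \<open>Operators are total functions; only their values on \<open>seq_space p\<close> matter.\<close>

definition bounded_op :: "ereal \<Rightarrow> ((int \<Rightarrow> complex) \<Rightarrow> int \<Rightarrow> complex) \<Rightarrow> bool" where
  "bounded_op p T \<longleftrightarrow>
     T \<in> seq_space p \<rightarrow> seq_space p \<and>
     (\<forall>x\<in>seq_space p. \<forall>y\<in>seq_space p. T (x + y) = T x + T y) \<and>
     (\<forall>c. \<forall>x\<in>seq_space p. T (cscale c x) = cscale c (T x)) \<and>
     (\<exists>C. \<forall>x\<in>seq_space p. seq_norm p (T x) \<le> C * seq_norm p x)"

definition op_spectrum :: "ereal \<Rightarrow> ((int \<Rightarrow> complex) \<Rightarrow> int \<Rightarrow> complex) \<Rightarrow> complex set" where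
  "op_spectrum p T =
     {l. \<not> (\<exists>S. bounded_op p S \<and>
            (\<forall>x\<in>seq_space p. S (T x - cscale l x) = x \<and> T (S x) - cscale l (S x) = x))}"

definition quasinilpotent_op :: "ereal \<Rightarrow> ((int \<Rightarrow> complex) \<Rightarrow> int \<Rightarrow> complex) \<Rightarrow> bool" where
  "quasinilpotent_op p T \<longleftrightarrow> bounded_op p T \<and> op_spectrum p T = {0}"

definition compact_op :: "ereal \<Rightarrow> ((int \<Rightarrow> complex) \<Rightarrow> int \<Rightarrow> complex) \<Rightarrow> bool" where
  "compact_op p T \<longleftrightarrow> bounded_op p T \<and>
     compactin (seq_top p) (seq_top p closure_of (T ` {x \<in> seq_space p. seq_norm p x \<le> 1}))"

definition cyclic_op :: "ereal \<Rightarrow> ((int \<Rightarrow> complex) \<Rightarrow> int \<Rightarrow> complex) \<Rightarrow> bool" where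
  "cyclic_op p T \<longleftrightarrow> bounded_op p T \<and>
     (\<exists>x\<in>seq_space p. seq_top p closure_of (cseq.span {(T ^^ n) x |n. True}) = seq_space p)"

definition canon_basis :: "int \<Rightarrow> int \<Rightarrow> complex" where
  "canon_basis n = (\<lambda>k. if k = n then 1 else 0)"

definition weighted_shift :: "(int \<Rightarrow> complex) \<Rightarrow> (int \<Rightarrow> complex) \<Rightarrow> int \<Rightarrow> complex" where
  "weighted_shift w x = (\<lambda>k. w (k + 1) * x (k + 1))"

lemma weighted_shift_canon_basis:
  "weighted_shift w (canon_basis n) = cscale (w n) (canon_basis (n - 1))"
  by (auto simp: weighted_shift_def canon_basis_def cscale_def fun_eq_iff)


section \<open>The spaces are metric and the shifts are bounded operators\<close>

lemma powr_convex_nonneg: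
  fixes a b u v r :: real
  assumes "1 \<le> r" "0 \<le> a" "0 \<le> b" "0 \<le> u" "0 \<le> v" "u + v = 1"
  shows "(u * a + v * b) powr r \<le> u * a powr r + v * b powr r"
proof -
  have le: "t powr r \<le> t" if "0 \<le> t" "t \<le> 1" for t :: real
    using powr_mono'[of 1 r t] that assms(1) by (cases "t = 0") auto
  consider "a = 0" | "b = 0" | "0 < a" "0 < b" using assms by linarith
  then show ?thesis
  proof cases
    case 1
    then show ?thesis using le[of v] assms by (simp add: powr_mult mult_right_mono)
  next
    case 2
    then show ?thesis using le[of u] assms by (simp add: powr_mult mult_right_mono)
  next
    case 3
    have u: "u = 1 - v" and "v \<le> 1" using assms by simp_all
    have "((1 - v) *\<^sub>R a + v *\<^sub>R b) powr r \<le> (1 - v) * a powr r + v * b powr r"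
      by (rule convex_onD[OF powr_convex[OF assms(1)]]) (use \<open>v \<le> 1\<close> assms(5) 3 in simp_all)
    then show ?thesis by (simp only: u real_scaleR_def)
  qed
qed

context
  fixes p :: ereal
  assumes p: "1 \<le> p"
begin

lemma real_p: "p \<noteq> \<infinity> \<Longrightarrow> 1 \<le> real_of_ereal p"
  using p by (cases p) auto

lemma c0_bdd:
  fixes x :: "int \<Rightarrow> complex"
  assumes "(x \<longlongrightarrow> 0) cofinite"
  shows "bdd_above (range (\<lambda>n. cmod (x n)))"
proof -
  have "finite {n. \<not> cmod (x n) < 1}"
    using tendstoD[OF assms, of 1] by (simp add: eventually_cofinite)
  then have "bdd_above ((\<lambda>n. cmod (x n)) ` {n. \<not> cmod (x n) < 1})"
    by (intro bdd_above_finite finite_imageI)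
  moreover have "bdd_above ((\<lambda>n. cmod (x n)) ` {n. cmod (x n) < 1})"
    by (auto intro!: bdd_aboveI[of _ 1])
  ultimately have "bdd_above ((\<lambda>n. cmod (x n)) ` {n. \<not> cmod (x n) < 1}
                      \<union> (\<lambda>n. cmod (x n)) ` {n. cmod (x n) < 1})"
    by simp
  moreover have "(\<lambda>n. cmod (x n)) ` {n. \<not> cmod (x n) < 1}
      \<union> (\<lambda>n. cmod (x n)) ` {n. cmod (x n) < 1} = range (\<lambda>n. cmod (x n))"
    by auto
  ultimately show ?thesis by simp
qed

lemma seq_norm_nonneg: "x \<in> seq_space p \<Longrightarrow> 0 \<le> seq_norm p x"
  by (auto simp: seq_norm_def seq_space_def intro: cSUP_upper2[OF c0_bdd, of x 0])

lemma cmod_le_seq_norm: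
  assumes x: "x \<in> seq_space p"
  shows "cmod (x k) \<le> seq_norm p x"
proof (cases "p = \<infinity>")
  case True
  then show ?thesis using x by (auto simp: seq_norm_def seq_space_def intro: cSUP_upper c0_bdd)
next
  case False
  define r where "r = real_of_ereal p"
  have r: "1 \<le> r" using real_p[OF False] r_def by simp
  have s: "(\<lambda>n. cmod (x n) powr r) summable_on UNIV"
    using x False by (simp add: seq_space_def r_def)
  have "cmod (x k) powr r = (\<Sum>\<^sub>\<infinity>n\<in>{k}. cmod (x n) powr r)" by simp
  also have "\<dots> \<le> (\<Sum>\<^sub>\<infinity>n. cmod (x n) powr r)"
    by (rule infsum_mono_neutral[OF _ s]) auto
  finally have "(cmod (x k) powr r) powr (1/r) \<le> (\<Sum>\<^sub>\<infinity>n. cmod (x n) powr r) powr (1/r)"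
    using r by (intro powr_mono2) auto
  then show ?thesis using r False by (simp add: powr_powr seq_norm_def r_def)
qed

lemma seq_norm_eq_0:
  assumes "x \<in> seq_space p"
  shows "seq_norm p x = 0 \<longleftrightarrow> x = 0"
proof
  assume "seq_norm p x = 0"
  then show "x = 0" using cmod_le_seq_norm[OF assms] by (auto simp: fun_eq_iff)
next
  assume "x = 0"
  then show "seq_norm p x = 0" by (auto simp: seq_norm_def)
qed

lemma seq_space_add_norm:
  assumes x: "x \<in> seq_space p" and y: "y \<in> seq_space p"
  shows "x + y \<in> seq_space p \<and> seq_norm p (x + y) \<le> seq_norm p x + seq_norm p y"
proof (cases "p = \<infinity>")
  case True
  have "((\<lambda>n. x n + y n) \<longlongrightarrow> 0 + 0) cofinite"
    using x y True by (intro tendsto_add) (auto simp: seq_space_def)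
  then have "x + y \<in> seq_space p" using True by (simp add: seq_space_def plus_fun_def)
  moreover have "(SUP n. cmod ((x + y) n)) \<le> seq_norm p x + seq_norm p y"
    using cmod_le_seq_norm[OF x] cmod_le_seq_norm[OF y]
    by (intro cSUP_least) (auto intro: order.trans[OF norm_triangle_ineq] add_mono)
  ultimately show ?thesis using True by (simp add: seq_norm_def)
next
  case False
  define r A B where "r = real_of_ereal p" and "A = seq_norm p x" and "B = seq_norm p y"
  have r: "1 \<le> r" using real_p[OF False] r_def by simp
  have sx: "(\<lambda>n. cmod (x n) powr r) summable_on UNIV"
    and sy: "(\<lambda>n. cmod (y n) powr r) summable_on UNIV"
    using x y False by (simp_all add: seq_space_def r_def)
  show ?thesis
  proof (cases "A = 0 \<or> B = 0")
    case True
    then show ?thesis using x y seq_norm_eq_0 A_def B_def by fastforce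
  next
    case nz: False
    have A: "0 < A" and B: "0 < B"
      using nz seq_norm_nonneg[OF x] seq_norm_nonneg[OF y] by (auto simp: A_def B_def)
    have Ar: "(\<Sum>\<^sub>\<infinity>n. cmod (x n) powr r) = A powr r"
      using r False
      by (simp add: A_def seq_norm_def r_def[symmetric] powr_powr infsum_nonneg)
    have Br: "(\<Sum>\<^sub>\<infinity>n. cmod (y n) powr r) = B powr r"
      using r False
      by (simp add: B_def seq_norm_def r_def[symmetric] powr_powr infsum_nonneg)
    define c d where "c = (A + B) powr r * (A / (A + B)) / A powr r"
      and "d = (A + B) powr r * (B / (A + B)) / B powr r"
    have bound: "cmod ((x + y) n) powr r \<le> c * cmod (x n) powr r + d * cmod (y n) powr r" for n
    proof -
      have uv: "A / (A + B) + B / (A + B) = 1" using A B by (simp flip: add_divide_distrib)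
      have e: "cmod (x n) + cmod (y n)
          = (A + B) * (A / (A + B) * (cmod (x n) / A) + B / (A + B) * (cmod (y n) / B))"
      proof -
        have "(A + B) * (A / (A + B) * (cmod (x n) / A)) = cmod (x n)"
          "(A + B) * (B / (A + B) * (cmod (y n) / B)) = cmod (y n)"
          using A B by simp_all
        then show ?thesis by (simp only: distrib_left)
      qed
      have "cmod ((x + y) n) powr r \<le> (cmod (x n) + cmod (y n)) powr r"
        using r by (intro powr_mono2) (auto intro: norm_triangle_ineq)
      also have "\<dots> = (A + B) powr r *
          (A / (A + B) * (cmod (x n) / A) + B / (A + B) * (cmod (y n) / B)) powr r"
        using A B by (subst e, subst powr_mult) auto
      also have "\<dots> \<le> (A + B) powr r *
          (A / (A + B) * (cmod (x n) / A) powr r + B / (A + B) * (cmod (y n) / B) powr r)"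
        using A B r uv by (intro mult_left_mono powr_convex_nonneg) auto
      also have "\<dots> = c * cmod (x n) powr r + d * cmod (y n) powr r"
        using A B by (simp add: c_def d_def powr_divide distrib_left)
      finally show ?thesis .
    qed
    have sc: "(\<lambda>n. c * cmod (x n) powr r) summable_on UNIV"
      and sd: "(\<lambda>n. d * cmod (y n) powr r) summable_on UNIV"
      using sx sy by (auto intro: summable_on_cmult_right)
    have ss: "(\<lambda>n. c * cmod (x n) powr r + d * cmod (y n) powr r) summable_on UNIV"
      by (intro summable_on_add sc sd)
    have sxy: "(\<lambda>n. cmod ((x + y) n) powr r) summable_on UNIV"
      by (rule summable_on_comparison_test[OF ss]) (use bound in auto)
    have "(\<Sum>\<^sub>\<infinity>n. cmod ((x + y) n) powr r)
        \<le> (\<Sum>\<^sub>\<infinity>n. c * cmod (x n) powr r + d * cmod (y n) powr r)"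
      by (intro infsum_mono sxy ss bound)
    also have "\<dots> = c * A powr r + d * B powr r"
      by (simp add: infsum_add[OF sc sd] infsum_cmult_right' Ar Br)
    also have "\<dots> = (A + B) powr r * (A / (A + B) + B / (A + B))"
      using A B by (simp add: c_def d_def distrib_left)
    also have "\<dots> = (A + B) powr r"
      using A B by (simp flip: add_divide_distrib)
    finally have "(\<Sum>\<^sub>\<infinity>n. cmod ((x + y) n) powr r) powr (1/r) \<le> ((A + B) powr r) powr (1/r)"
      using r by (intro powr_mono2) (auto simp: infsum_nonneg)
    also have "\<dots> = A + B" using r A B by (simp add: powr_powr)
    finally show ?thesis
      using sxy False by (simp add: seq_space_def seq_norm_def r_def A_def B_def)
  qed
qed

text \<open>Multiplication by a bounded sequence followed by a translation; scalar multiples and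
  weighted shifts are both special cases.\<close>

lemma seq_space_mult_shift:
  fixes v :: "int \<Rightarrow> complex" and C :: real and m :: int
  assumes x: "x \<in> seq_space p" and v: "\<And>k. cmod (v k) \<le> C"
  shows "(\<lambda>k. v (k + m) * x (k + m)) \<in> seq_space p \<and>
         seq_norm p (\<lambda>k. v (k + m) * x (k + m)) \<le> C * seq_norm p x"
proof -
  have C: "0 \<le> C" using v[of 0] norm_ge_zero order.trans by blast
  have bij: "bij (\<lambda>k. k + m)" by (rule bij_plus_right)
  show ?thesis
  proof (cases "p = \<infinity>")
    case True
    have x0: "(x \<longlongrightarrow> 0) cofinite" using x True by (simp add: seq_space_def)
    have "((\<lambda>k. v k * x k) \<longlongrightarrow> 0) cofinite"
    proof (rule Lim_null_comparison)
      show "\<forall>\<^sub>F k in cofinite. cmod (v k * x k) \<le> C * cmod (x k)"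
        using v by (auto simp: norm_mult intro!: always_eventually mult_right_mono)
      show "((\<lambda>k. C * cmod (x k)) \<longlongrightarrow> 0) cofinite"
        using tendsto_mult[OF tendsto_const[of C] tendsto_norm_zero[OF x0]] by simp
    qed
    moreover have "filterlim (\<lambda>k. k + m) cofinite cofinite"
      unfolding filterlim_iff eventually_cofinite
    proof (intro allI impI)
      fix P :: "int \<Rightarrow> bool" assume "finite {k. \<not> P k}"
      from finite_vimageI[OF this bij_is_inj[OF bij]]
      show "finite {k. \<not> P (k + m)}" by (simp only: vimage_Collect_eq)
    qed
    ultimately have "((\<lambda>k. v (k + m) * x (k + m)) \<longlongrightarrow> 0) cofinite"
      by (rule filterlim_compose)
    moreover have "(SUP k. cmod (v (k + m) * x (k + m))) \<le> C * seq_norm p x"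
      using cmod_le_seq_norm[OF x] v C
      by (intro cSUP_least) (auto simp: norm_mult intro!: mult_mono)
    ultimately show ?thesis using True by (simp add: seq_space_def seq_norm_def)
  next
    case False
    define r where "r = real_of_ereal p"
    have r: "1 \<le> r" using real_p[OF False] r_def by simp
    have sx: "(\<lambda>n. cmod (x n) powr r) summable_on UNIV"
      using x False by (simp add: seq_space_def r_def)
    have bound: "cmod (v k * x k) powr r \<le> C powr r * cmod (x k) powr r" for k
    proof -
      have "cmod (v k * x k) powr r \<le> (C * cmod (x k)) powr r"
        using r v by (intro powr_mono2) (auto simp: norm_mult intro: mult_right_mono)
      then show ?thesis using C by (simp add: powr_mult)
    qed
    have sC: "(\<lambda>k. C powr r * cmod (x k) powr r) summable_on UNIV"
      using sx by (rule summable_on_cmult_right)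
    have sv: "(\<lambda>k. cmod (v k * x k) powr r) summable_on UNIV"
      by (rule summable_on_comparison_test[OF sC]) (use bound in auto)
    have sm: "(\<lambda>k. cmod (v (k + m) * x (k + m)) powr r) summable_on UNIV"
      using summable_on_reindex_bij_betw[OF bij, of "\<lambda>k. cmod (v k * x k) powr r"] sv by simp
    have "(\<Sum>\<^sub>\<infinity>k. cmod (v (k + m) * x (k + m)) powr r) = (\<Sum>\<^sub>\<infinity>k. cmod (v k * x k) powr r)"
      using infsum_reindex_bij_betw[OF bij, of "\<lambda>k. cmod (v k * x k) powr r"] by simp
    also have "\<dots> \<le> (\<Sum>\<^sub>\<infinity>k. C powr r * cmod (x k) powr r)"
      by (intro infsum_mono sv sC bound)
    also have "\<dots> = C powr r * (\<Sum>\<^sub>\<infinity>k. cmod (x k) powr r)"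
      by (rule infsum_cmult_right')
    finally have "(\<Sum>\<^sub>\<infinity>k. cmod (v (k + m) * x (k + m)) powr r) powr (1/r)
        \<le> (C powr r * (\<Sum>\<^sub>\<infinity>k. cmod (x k) powr r)) powr (1/r)"
      using r by (intro powr_mono2) (auto simp: infsum_nonneg)
    also have "\<dots> = C * (\<Sum>\<^sub>\<infinity>k. cmod (x k) powr r) powr (1/r)"
      using r C by (simp add: powr_mult powr_powr infsum_nonneg)
    finally show ?thesis
      using sm False by (simp add: seq_space_def seq_norm_def r_def)
  qed
qed

lemma seq_space_scale: "x \<in> seq_space p \<Longrightarrow> cscale c x \<in> seq_space p"
  using seq_space_mult_shift[of x "\<lambda>_. c" "cmod c" 0] by (simp add: cscale_def)

lemma seq_space_subspace: "cseq.subspace (seq_space p)"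
proof (rule cseq.subspaceI)
  show "0 \<in> seq_space p" by (auto simp: seq_space_def zero_fun_def)
qed (use seq_space_add_norm seq_space_scale in auto)

lemma seq_norm_minus_commute: "seq_norm p (x - y) = seq_norm p (y - x)"
  by (simp add: seq_norm_def norm_minus_commute)

lemma Metric_space_seq: "Metric_space (seq_space p) (seq_dist p)"
proof
  show "0 \<le> seq_dist p x y" for x y by (simp add: seq_dist_def seq_norm_nonneg)
  show "seq_dist p x y = seq_dist p y x" for x y
    using cseq.subspace_neg[OF seq_space_subspace, of "x - y"]
      cseq.subspace_neg[OF seq_space_subspace, of "y - x"]
    by (auto simp: seq_dist_def seq_norm_minus_commute)
next
  fix x y assume "x \<in> seq_space p" "y \<in> seq_space p"
  then have "x - y \<in> seq_space p" by (rule cseq.subspace_diff[OF seq_space_subspace])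
  then show "seq_dist p x y = 0 \<longleftrightarrow> x = y" by (simp add: seq_dist_def seq_norm_eq_0)
next
  fix x y z assume "x \<in> seq_space p" "y \<in> seq_space p" "z \<in> seq_space p"
  then have "x - y \<in> seq_space p" "y - z \<in> seq_space p" "x - z \<in> seq_space p"
    by (auto intro: cseq.subspace_diff[OF seq_space_subspace])
  then show "seq_dist p x z \<le> seq_dist p x y + seq_dist p y z"
    using seq_space_add_norm[of "x - y" "y - z"] by (simp add: seq_dist_def)
qed

lemma bounded_op_weighted_shift:
  assumes "bounded (range w)"
  shows "bounded_op p (weighted_shift w)"
proof -
  obtain C where C: "\<And>k. cmod (w k) \<le> C" using assms by (auto simp: bounded_iff)
  have "weighted_shift w x \<in> seq_space p \<and> seq_norm p (weighted_shift w x) \<le> C * seq_norm p x"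
    if "x \<in> seq_space p" for x
    using seq_space_mult_shift[of x w C 1, OF that C] by (simp add: weighted_shift_def)
  moreover have "weighted_shift w (x + y) = weighted_shift w x + weighted_shift w y"
    "weighted_shift w (cscale c x) = cscale c (weighted_shift w x)" for x y c
    by (auto simp: weighted_shift_def cscale_def fun_eq_iff algebra_simps)
  ultimately show ?thesis unfolding bounded_op_def by blast
qed

end

end

theory Submission
  imports Defs "HOL-Computational_Algebra.Fundamental_Theorem_Algebra"
begin

text \<open>
  Write \<open>T\<close> for the shift and \<open>e\<^sub>n\<close> for the basis vectors. Since \<open>T e\<^sub>n\<close> is a non-zero multiple
  of \<open>e\<^sub>n\<^sub>-\<^sub>1\<close>, a vector \<open>v\<close> supported in \<open>{0..N}\<close> has the form \<open>U(T) e\<^sub>N\<close> for a polynomial \<open>U\<close>, and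
  \<open>U(0) \<noteq> 0\<close> as soon as \<open>v\<close> does not vanish at \<open>N\<close>. Formally \<open>U(T)\<close> is then invertible with an
  inverse that is a power series in \<open>T\<close>, so the closed span of the orbit of \<open>v\<close> should contain
  \<open>e\<^sub>N\<close>, and with it all \<open>e\<^sub>j\<close> with \<open>j \<le> N\<close>. No finitely supported vector reaches beyond its last
  index, but a vector \<open>x = \<Sum>n. a\<^sub>n e\<^sub>n\<close> (sum over \<open>n \<ge> 0\<close>) does if its coefficients decrease fast enough:
  a polynomial \<open>Q\<close> that brings \<open>Q(T)\<close> of the \<open>N\<close>-th partial sum close to \<open>e\<^sub>j\<close> is chosen before
  \<open>a\<^sub>N\<^sub>+\<^sub>1\<close>, so the remaining coefficients can be taken so small that \<open>Q(T) x\<close> is still close to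
  \<open>e\<^sub>j\<close>. This gives a cyclic vector (\<open>cyclic_if_absorbs\<close>).

  The invertibility is used only in the following weak form. Let \<open>M\<close> be a closed \<open>T\<close>-invariant
  subspace. By the fundamental theorem of algebra \<open>U\<close> is a product of linear factors with
  non-zero roots, so \<open>U(T) y \<in> M\<close> implies \<open>y \<in> M\<close> once \<open>T y - l y \<in> M\<close> implies \<open>y \<in> M\<close> for all
  \<open>l \<noteq> 0\<close> (\<open>cancel_op_poly\<close>). The last property, called \<open>absorbs\<close> below, holds in both cases of
  the theorem:

  \<^item> If the spectrum of \<open>T\<close> is \<open>{0}\<close>, the property holds for large \<open>l\<close> and is locally constant in
    \<open>l\<close>, and the punctured plane is connected (\<open>quasinilpotent_absorbs\<close>). This replaces the
    spectral radius formula.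

  \<^item> If \<open>T\<close> is compact, its weights tend to \<open>0\<close>, because \<open>T e\<^sub>n\<close> and \<open>T e\<^sub>m\<close> with \<open>n \<noteq> m\<close> are at
    distance at least \<open>\<bar>w\<^sub>n\<bar>\<close> from each other. Hence \<open>(T / l)\<^sup>k y\<close> tends to \<open>0\<close>, while
    \<open>y - (T / l)\<^sup>k y\<close> stays in \<open>M\<close> if \<open>T y - l y\<close> lies in \<open>M\<close>
    (\<open>compact_shift_absorbs\<close>).
\<close>

section \<open>Closed subspaces and polynomials in an operator\<close>

definition closed_subspace :: "ereal \<Rightarrow> (int \<Rightarrow> complex) set \<Rightarrow> bool" where
  "closed_subspace p M \<longleftrightarrow>
     cseq.subspace M \<and> M \<subseteq> seq_space p \<and>
     (\<forall>y\<in>seq_space p. (\<forall>e>0. \<exists>z\<in>M. seq_norm p (y - z) < e) \<longrightarrow> y \<in> M)"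

text \<open>For a \<open>T\<close>-invariant subspace \<open>M\<close>: \<open>l\<close> is not an eigenvalue of the map that \<open>T\<close> induces on the
  quotient by \<open>M\<close>.\<close>

definition absorbs :: "ereal \<Rightarrow> ((int \<Rightarrow> complex) \<Rightarrow> int \<Rightarrow> complex) \<Rightarrow> (int \<Rightarrow> complex) set \<Rightarrow> complex \<Rightarrow> bool" where
  "absorbs p T M l \<longleftrightarrow> (\<forall>y\<in>seq_space p. T y - cscale l y \<in> M \<longrightarrow> y \<in> M)"

text \<open>Horner's scheme makes \<open>pCons\<close> the natural case of every induction on the polynomial.\<close>

definition op_poly ::
  "((int \<Rightarrow> complex) \<Rightarrow> int \<Rightarrow> complex) \<Rightarrow> complex poly \<Rightarrow> (int \<Rightarrow> complex) \<Rightarrow> int \<Rightarrow> complex" where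
  "op_poly T U = fold_coeffs (\<lambda>a f y. cscale a y + T (f y)) U (\<lambda>_. 0)"

context
  fixes p :: ereal
  assumes p: "1 \<le> p"
begin

section \<open>The norm and bounded operators\<close>

abbreviation "X \<equiv> seq_space p"
abbreviation "nrm \<equiv> seq_norm p"

lemma X_zero: "0 \<in> X"
  using seq_space_subspace[OF p] by (rule cseq.subspace_0)

lemma X_add: "x \<in> X \<Longrightarrow> y \<in> X \<Longrightarrow> x + y \<in> X"
  using seq_space_subspace[OF p] by (rule cseq.subspace_add)

lemma X_diff: "x \<in> X \<Longrightarrow> y \<in> X \<Longrightarrow> x - y \<in> X"
  using seq_space_subspace[OF p] by (rule cseq.subspace_diff)

lemma X_scale: "x \<in> X \<Longrightarrow> cscale c x \<in> X"
  using seq_space_subspace[OF p] by (rule cseq.subspace_scale)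

lemma nrm_zero: "nrm 0 = 0"
  using seq_norm_eq_0[OF p X_zero] by simp

lemma nrm_add: "x \<in> X \<Longrightarrow> y \<in> X \<Longrightarrow> nrm (x + y) \<le> nrm x + nrm y"
  using seq_space_add_norm[OF p] by blast

lemma nrm_triangle:
  assumes "x \<in> X" "y \<in> X" "z \<in> X"
  shows "nrm (x - z) \<le> nrm (x - y) + nrm (y - z)"
  using nrm_add[OF X_diff[OF assms(1,2)] X_diff[OF assms(2,3)]] by simp

lemma nrm_scale: "x \<in> X \<Longrightarrow> nrm (cscale c x) \<le> cmod c * nrm x"
  using seq_space_mult_shift[OF p, of x "\<lambda>_. c" "cmod c" 0] by (simp add: cscale_def)

lemma bounded_op_mem: "bounded_op p T \<Longrightarrow> x \<in> X \<Longrightarrow> T x \<in> X"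
  by (auto simp: bounded_op_def)

lemma bounded_op_add: "bounded_op p T \<Longrightarrow> x \<in> X \<Longrightarrow> y \<in> X \<Longrightarrow> T (x + y) = T x + T y"
  by (auto simp: bounded_op_def)

lemma bounded_op_scale: "bounded_op p T \<Longrightarrow> x \<in> X \<Longrightarrow> T (cscale c x) = cscale c (T x)"
  by (auto simp: bounded_op_def)

lemma bounded_op_zero: "bounded_op p T \<Longrightarrow> T 0 = 0"
  using bounded_op_scale[of T 0 0] X_zero by simp

lemma bounded_op_diff:
  assumes "bounded_op p T" "x \<in> X" "y \<in> X"
  shows "T (x - y) = T x - T y"
  using bounded_op_add[OF assms(1) X_diff[OF assms(2,3)] assms(3)] by (simp add: algebra_simps)

lemma bounded_op_bound:
  assumes "bounded_op p T"
  shows "\<exists>C>0. \<forall>x\<in>X. nrm (T x) \<le> C * nrm x"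
proof -
  obtain C where C: "\<forall>x\<in>X. nrm (T x) \<le> C * nrm x"
    using assms by (auto simp: bounded_op_def)
  have "nrm (T x) \<le> (\<bar>C\<bar> + 1) * nrm x" if "x \<in> X" for x
    using C that by (smt (verit, best) mult_right_mono seq_norm_nonneg[OF p])
  then show ?thesis by (intro exI[of _ "\<bar>C\<bar> + 1"]) auto
qed

lemma bounded_op_Horner:
  assumes T: "bounded_op p T" and Q: "bounded_op p Q"
  shows "bounded_op p (\<lambda>x. cscale a x + T (Q x))"
proof -
  obtain C where C: "0 < C" "\<And>x. x \<in> X \<Longrightarrow> nrm (T x) \<le> C * nrm x"
    using bounded_op_bound[OF T] by blast
  obtain D where D: "0 < D" "\<And>x. x \<in> X \<Longrightarrow> nrm (Q x) \<le> D * nrm x"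
    using bounded_op_bound[OF Q] by blast
  have "nrm (cscale a x + T (Q x)) \<le> (cmod a + C * D) * nrm x" if x: "x \<in> X" for x
  proof -
    have "nrm (cscale a x + T (Q x)) \<le> nrm (cscale a x) + nrm (T (Q x))"
      using bounded_op_mem[OF T bounded_op_mem[OF Q x]] X_scale[OF x] by (intro nrm_add)
    also have "\<dots> \<le> cmod a * nrm x + C * (D * nrm x)"
      using nrm_scale[OF x] C(2)[OF bounded_op_mem[OF Q x]] D(2)[OF x] C(1)
      by (smt (verit, best) mult_left_mono)
    finally show ?thesis by (simp add: algebra_simps)
  qed
  moreover have "cscale a (x + y) + T (Q (x + y)) = cscale a x + T (Q x) + (cscale a y + T (Q y))"
    if "x \<in> X" "y \<in> X" for x y
    using that by (simp add: bounded_op_add[OF Q] bounded_op_add[OF T] bounded_op_mem[OF Q]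
        cseq.scale_right_distrib)
  moreover have "cscale a (cscale c x) + T (Q (cscale c x)) = cscale c (cscale a x + T (Q x))"
    if "x \<in> X" for x c
    using that by (simp add: bounded_op_scale[OF Q] bounded_op_scale[OF T] bounded_op_mem[OF Q]
        cseq.scale_right_distrib mult.commute)
  ultimately show ?thesis
    unfolding bounded_op_def
    using X_add[OF X_scale bounded_op_mem[OF T bounded_op_mem[OF Q]]] by blast
qed

lemma bounded_op_null: "bounded_op p (\<lambda>_. 0)"
  unfolding bounded_op_def using X_zero nrm_zero by (auto intro: exI[of _ 0])

lemma bounded_op_cscale: "bounded_op p S \<Longrightarrow> bounded_op p (\<lambda>x. cscale c (S x))"
proof -
  assume S: "bounded_op p S"
  have "bounded_op p (\<lambda>x. cscale c x + S 0)"
    using bounded_op_Horner[OF S bounded_op_null] .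
  then have "bounded_op p (\<lambda>x. cscale c x)" by (simp add: bounded_op_zero[OF S])
  from bounded_op_Horner[OF this S, of 0] show ?thesis by simp
qed

section \<open>Closed invariant subspaces\<close>

lemma closed_subspaceD:
  assumes "closed_subspace p M"
  shows "cseq.subspace M" "M \<subseteq> X"
    and "\<And>y. y \<in> X \<Longrightarrow> (\<And>e. 0 < e \<Longrightarrow> \<exists>z\<in>M. nrm (y - z) < e) \<Longrightarrow> y \<in> M"
  using assms by (auto simp: closed_subspace_def)

lemma mem_closure_seq_top:
  assumes "S \<subseteq> X"
  shows "y \<in> seq_top p closure_of S \<longleftrightarrow> y \<in> X \<and> (\<forall>e>0. \<exists>z\<in>S. nrm (y - z) < e)"
proof -
  interpret Metric_space X "seq_dist p" using Metric_space_seq[OF p] .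
  have "z \<in> mball y e \<longleftrightarrow> y \<in> X \<and> z \<in> X \<and> nrm (y - z) < e" for y z e
    using X_diff by (auto simp: in_mball seq_dist_def)
  then have "(\<exists>z\<in>S. z \<in> mball y e) \<longleftrightarrow> (\<exists>z\<in>S. nrm (y - z) < e)" if "y \<in> X" for e
    using assms that by blast
  then show ?thesis
    unfolding seq_top_def metric_closure_of by auto
qed

lemma closed_subspace_closure:
  assumes S: "cseq.subspace S" "S \<subseteq> X"
  shows "closed_subspace p (seq_top p closure_of S)"
proof -
  let ?M = "seq_top p closure_of S"
  note mem = mem_closure_seq_top[OF S(2)]
  have sub: "S \<subseteq> ?M"
  proof
    fix x assume x: "x \<in> S"
    then have "nrm (x - x) < e" if "0 < e" for e using that nrm_zero by simp
    then show "x \<in> ?M" using x S(2) unfolding mem by blast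
  qed
  have X: "x \<in> X" if "x \<in> ?M" for x using that mem by blast
  have close: "\<exists>a. a \<in> S \<and> a \<in> X \<and> nrm (x - a) < e" if "x \<in> ?M" "0 < e" for x e
    using that mem S(2) by blast
  have add: "x + y \<in> ?M" if x: "x \<in> ?M" and y: "y \<in> ?M" for x y
    unfolding mem
  proof (intro conjI allI impI)
    show "x + y \<in> X" by (intro X_add X that)
    fix e :: real assume e: "0 < e"
    have e2: "0 < e / 2" using e by simp
    obtain a where a: "a \<in> S" "a \<in> X" "nrm (x - a) < e / 2" using close[OF x e2] by blast
    obtain b where b: "b \<in> S" "b \<in> X" "nrm (y - b) < e / 2" using close[OF y e2] by blast
    have "nrm ((x - a) + (y - b)) \<le> nrm (x - a) + nrm (y - b)"
      by (intro nrm_add X_diff X that a b)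
    moreover have "(x - a) + (y - b) = (x + y) - (a + b)" by (simp add: algebra_simps)
    ultimately have "nrm ((x + y) - (a + b)) < e" using a b by simp
    then show "\<exists>z\<in>S. nrm (x + y - z) < e"
      using cseq.subspace_add[OF S(1) a(1) b(1)] by blast
  qed
  have scale: "cscale c x \<in> ?M" if "x \<in> ?M" for c x
    unfolding mem
  proof (intro conjI allI impI)
    show "cscale c x \<in> X" by (intro X_scale X that)
    fix e :: real assume e: "0 < e"
    have "0 < e / (cmod c + 1)" using e by (simp add: add_nonneg_pos)
    from close[OF that this] obtain a
      where a: "a \<in> S" "a \<in> X" "nrm (x - a) < e / (cmod c + 1)" by blast
    have xa: "x - a \<in> X" by (intro X_diff X that a)
    have "nrm (cscale c x - cscale c a) \<le> cmod c * nrm (x - a)"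
      using nrm_scale[OF xa] by (simp add: cseq.scale_right_diff_distrib)
    also have "\<dots> \<le> (cmod c + 1) * nrm (x - a)"
      using seq_norm_nonneg[OF p xa] by (simp add: mult_right_mono)
    also have "\<dots> < e" using a(3) by (simp add: pos_less_divide_eq add_nonneg_pos mult.commute)
    finally show "\<exists>z\<in>S. nrm (cscale c x - z) < e"
      using cseq.subspace_scale[OF S(1) a(1)] by blast
  qed
  have "y \<in> ?M" if y: "y \<in> X" and ap: "\<forall>e>0. \<exists>z\<in>?M. nrm (y - z) < e" for y
    unfolding mem
  proof (intro conjI allI impI y)
    fix e :: real assume e: "0 < e"
    have e2: "0 < e / 2" using e by simp
    then obtain z where z: "z \<in> ?M" "nrm (y - z) < e / 2" using ap by blast
    obtain a where a: "a \<in> S" "a \<in> X" "nrm (z - a) < e / 2" using close[OF z(1) e2] by blast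
    have "nrm (y - a) \<le> nrm (y - z) + nrm (z - a)"
      by (intro nrm_triangle y X z a)
    then show "\<exists>z\<in>S. nrm (y - z) < e" using z a by force
  qed
  then show ?thesis
    unfolding closed_subspace_def
    using X add scale sub cseq.subspace_0[OF S(1)] by (auto intro!: cseq.subspaceI)
qed

lemma closure_invariant:
  assumes T: "bounded_op p T" and S: "S \<subseteq> X" "T ` S \<subseteq> S"
  shows "T ` (seq_top p closure_of S) \<subseteq> seq_top p closure_of S"
proof (intro image_subsetI)
  note mem = mem_closure_seq_top[OF S(1)]
  obtain C where C: "0 < C" "\<And>x. x \<in> X \<Longrightarrow> nrm (T x) \<le> C * nrm x"
    using bounded_op_bound[OF T] by blast
  fix x assume x: "x \<in> seq_top p closure_of S"
  have xX: "x \<in> X" using x mem by blast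
  show "T x \<in> seq_top p closure_of S"
    unfolding mem
  proof (intro conjI allI impI)
    show "T x \<in> X" using bounded_op_mem[OF T xX] .
    fix e :: real assume "0 < e"
    then have "0 < e / C" using C by simp
    then obtain a where a: "a \<in> S" "nrm (x - a) < e / C" using x mem by blast
    have aX: "a \<in> X" using a S by blast
    have "nrm (T x - T a) \<le> C * nrm (x - a)"
      using C(2)[OF X_diff[OF xX aX]] by (simp add: bounded_op_diff[OF T xX aX])
    also have "\<dots> < e" using a C by (simp add: field_simps)
    finally show "\<exists>z\<in>S. nrm (T x - z) < e" using a S(2) by blast
  qed
qed

text \<open>Modulo \<open>M\<close> the vector \<open>z\<close> is a fixed point of \<open>A\<close>, so \<open>z - A\<^sup>k z\<close> lies in \<open>M\<close> for every \<open>k\<close>; it tends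
  to \<open>z\<close>. All instances of \<open>absorbs\<close> are derived from this.\<close>

lemma mem_if_iterates_vanish:
  assumes M: "closed_subspace p M" and A: "bounded_op p A" and AM: "A ` M \<subseteq> M"
    and z: "z \<in> X" "z - A z \<in> M"
    and lim: "(\<lambda>k. nrm ((A ^^ k) z)) \<longlonglongrightarrow> 0"
  shows "z \<in> M"
proof -
  note D = closed_subspaceD[OF M]
  have AX: "(A ^^ k) z \<in> X" for k
    by (induction k) (auto simp: z bounded_op_mem[OF A])
  have step: "z - (A ^^ k) z \<in> M" for k
  proof (induction k)
    case 0
    show ?case using cseq.subspace_0[OF D(1)] by (simp only: funpow_0 diff_self)
  next
    case (Suc k)
    have "A (z - (A ^^ k) z) \<in> M" using Suc AM by blast
    then have "(z - A z) + A (z - (A ^^ k) z) \<in> M" using z cseq.subspace_add[OF D(1)] by blast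
    moreover have "(z - A z) + A (z - (A ^^ k) z) = z - (A ^^ Suc k) z"
      by (simp add: bounded_op_diff[OF A z(1) AX])
    ultimately show ?case by (simp only:)
  qed
  show ?thesis
  proof (rule D(3)[OF z(1)])
    fix e :: real assume "0 < e"
    then have "\<forall>\<^sub>F k in sequentially. nrm ((A ^^ k) z) < e" by (rule order_tendstoD(2)[OF lim])
    then obtain k where "nrm ((A ^^ k) z) < e" by (auto simp: eventually_sequentially)
    then have "nrm (z - (z - (A ^^ k) z)) < e" by simp
    then show "\<exists>y\<in>M. nrm (z - y) < e" using step by blast
  qed
qed

lemma contraction_iterates_vanish:
  assumes A: "bounded_op p A" and q: "0 \<le> q" "q < 1"
    and le: "\<And>x. x \<in> X \<Longrightarrow> nrm (A x) \<le> q * nrm x" and z: "z \<in> X"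
  shows "(\<lambda>k. nrm ((A ^^ k) z)) \<longlonglongrightarrow> 0"
proof -
  have AX: "(A ^^ k) z \<in> X" for k
    by (induction k) (auto simp: z bounded_op_mem[OF A])
  have b: "nrm ((A ^^ k) z) \<le> q ^ k * nrm z" for k
  proof (induction k)
    case (Suc k)
    have "nrm ((A ^^ Suc k) z) \<le> q * nrm ((A ^^ k) z)" using le[OF AX] by simp
    also have "\<dots> \<le> q * (q ^ k * nrm z)" using Suc q by (intro mult_left_mono) auto
    finally show ?case by (simp add: mult.assoc)
  qed simp
  have "(\<lambda>k. q ^ k * nrm z) \<longlonglongrightarrow> 0 * nrm z"
    using q by (intro tendsto_mult LIMSEQ_power_zero tendsto_const) auto
  then have "(\<lambda>k. q ^ k * nrm z) \<longlonglongrightarrow> 0" by simp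
  moreover have "\<forall>k. norm (nrm ((A ^^ k) z)) \<le> q ^ k * nrm z"
    using b seq_norm_nonneg[OF p AX] by simp
  ultimately show ?thesis by (rule Lim_null_comparison[OF always_eventually, rotated])
qed

section \<open>Quasinilpotent operators\<close>

definition inverse_at where
  "inverse_at T l S \<longleftrightarrow> bounded_op p S \<and>
     (\<forall>x\<in>X. S (T x - cscale l x) = x \<and> T (S x) - cscale l (S x) = x)"

text \<open>If \<open>T y - m y \<in> M\<close>, applying \<open>S = (T - l)\<^sup>-\<^sup>1\<close> shows that \<open>y - (m - l) S y\<close> is \<open>S\<close> of an element of
  \<open>M\<close>. The hypothesis at \<open>l\<close> says that \<open>S\<close> maps \<open>M\<close> into itself, and \<open>(m - l) S\<close> is a contraction.\<close>

lemma absorbs_nearby: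
  assumes T: "bounded_op p T" and M: "closed_subspace p M"
    and S: "inverse_at T l S" and C: "0 < C" "\<And>x. x \<in> X \<Longrightarrow> nrm (S x) \<le> C * nrm x"
    and near: "cmod (m - l) * C < 1" and ab: "absorbs p T M l"
  shows "absorbs p T M m"
  unfolding absorbs_def
proof (intro ballI impI)
  note D = closed_subspaceD[OF M]
  have bS: "bounded_op p S" and S1: "\<And>x. x \<in> X \<Longrightarrow> S (T x - cscale l x) = x"
    and S2: "\<And>x. x \<in> X \<Longrightarrow> T (S x) - cscale l (S x) = x"
    using S by (auto simp: inverse_at_def)
  note SX = bounded_op_mem[OF bS]
  have SM: "S x \<in> M" if "x \<in> M" for x
  proof -
    have "x \<in> X" using that D(2) by blast
    then have "T (S x) - cscale l (S x) \<in> M" using S2 that by simp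
    then show ?thesis using ab SX \<open>x \<in> X\<close> by (simp add: absorbs_def)
  qed
  define A where "A = (\<lambda>x. cscale (m - l) (S x))"
  have A: "bounded_op p A" unfolding A_def by (rule bounded_op_cscale[OF bS])
  have AM: "A ` M \<subseteq> M" using SM cseq.subspace_scale[OF D(1)] by (auto simp: A_def)
  have le: "nrm (A x) \<le> (cmod (m - l) * C) * nrm x" if "x \<in> X" for x
  proof -
    have "nrm (A x) \<le> cmod (m - l) * nrm (S x)" unfolding A_def using nrm_scale SX that by blast
    also have "\<dots> \<le> cmod (m - l) * (C * nrm x)" using C(2) that by (intro mult_left_mono) auto
    finally show ?thesis by simp
  qed
  fix y assume y: "y \<in> X" and yM: "T y - cscale m y \<in> M"
  have "T y - cscale l y = (T y - cscale m y) + cscale (m - l) y"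
    by (simp add: cseq.scale_left_diff_distrib)
  then have "y = S ((T y - cscale m y) + cscale (m - l) y)" using S1[OF y] by (simp only:)
  also have "\<dots> = S (T y - cscale m y) + A y"
    using y by (simp add: A_def bounded_op_add[OF bS] bounded_op_scale[OF bS] X_diff X_scale bounded_op_mem[OF T])
  finally have "y - A y = S (T y - cscale m y)" by (metis add_diff_cancel_right')
  then have "y - A y \<in> M" using SM yM by simp
  moreover have "(\<lambda>k. nrm ((A ^^ k) y)) \<longlonglongrightarrow> 0"
    by (rule contraction_iterates_vanish[OF A _ near le y]) (use C in auto)
  ultimately show "y \<in> M" using mem_if_iterates_vanish[OF M A AM y] by blast
qed

text \<open>A uniform bound on the resolvent near \<open>l\<close>, from the resolvent identity
  \<open>R = S + (m - l) S R\<close>. It allows \<open>absorbs_nearby\<close> to be used from \<open>m\<close> back to \<open>l\<close>, so that the set of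
  those \<open>l\<close> that are absorbed is closed as well as open.\<close>

lemma inverse_at_nearby_bound:
  assumes T: "bounded_op p T" and S: "inverse_at T l S" "\<And>x. x \<in> X \<Longrightarrow> nrm (S x) \<le> C * nrm x" "0 < C"
    and R: "inverse_at T m R" and near: "cmod (m - l) * (2 * C) < 1" and x: "x \<in> X"
  shows "nrm (R x) \<le> (2 * C) * nrm x"
proof -
  have "bounded_op p R" using R by (simp add: inverse_at_def)
  then have RX: "R x \<in> X" using x by (rule bounded_op_mem)
  have bS: "bounded_op p S" using S by (simp add: inverse_at_def)
  have "T (R x) - cscale l (R x) = x + cscale (m - l) (R x)"
  proof -
    have "T (R x) - cscale m (R x) = x" using R x by (simp add: inverse_at_def)
    then show ?thesis by (simp add: cseq.scale_left_diff_distrib algebra_simps)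
  qed
  then have "R x = S (x + cscale (m - l) (R x))" using S(1) RX by (metis inverse_at_def)
  then have "nrm (R x) \<le> C * nrm (x + cscale (m - l) (R x))"
    using S(2)[of "x + cscale (m - l) (R x)"] x RX X_add X_scale by auto
  also have "\<dots> \<le> C * (nrm x + cmod (m - l) * nrm (R x))"
    using S(3) nrm_add[OF x X_scale[OF RX, of "m - l"]] nrm_scale[OF RX, of "m - l"]
    by (intro mult_left_mono) linarith+
  finally have "nrm (R x) \<le> C * nrm x + (cmod (m - l) * C) * nrm (R x)" by (simp add: algebra_simps)
  moreover have "(cmod (m - l) * C) * nrm (R x) \<le> (1/2) * nrm (R x)"
    using near seq_norm_nonneg[OF p RX] by (intro mult_right_mono) auto
  ultimately show ?thesis by simp
qed

text \<open>The property holds at the point \<open>L\<close> beyond the norm of \<open>T\<close>, where \<open>T / L\<close> is a contraction, and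
  spreads from there over the connected set of non-zero complex numbers.\<close>

lemma quasinilpotent_absorbs:
  assumes T: "bounded_op p T" and sp: "op_spectrum p T \<subseteq> {0}"
    and M: "closed_subspace p M" and TM: "T ` M \<subseteq> M" and l: "l \<noteq> 0"
  shows "absorbs p T M l"
proof -
  note D = closed_subspaceD[OF M]
  have ex: "\<exists>S. inverse_at T m S" if "m \<noteq> 0" for m
  proof -
    have "m \<notin> op_spectrum p T" using sp that by blast
    then show ?thesis by (simp add: op_spectrum_def inverse_at_def)
  qed
  obtain C where C: "0 < C" "\<And>x. x \<in> X \<Longrightarrow> nrm (T x) \<le> C * nrm x"
    using bounded_op_bound[OF T] by blast
  define L where "L = complex_of_real (2 * C)"
  have L0: "L \<noteq> 0" and Ln: "cmod L = 2 * C" using C by (auto simp: L_def)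
  have "absorbs p T M L"
    unfolding absorbs_def
  proof (intro ballI impI)
    fix y assume y: "y \<in> X" and yM: "T y - cscale L y \<in> M"
    define A where "A = (\<lambda>x. cscale (1 / L) (T x))"
    have A: "bounded_op p A" unfolding A_def by (rule bounded_op_cscale[OF T])
    have AM: "A ` M \<subseteq> M" using TM cseq.subspace_scale[OF D(1)] by (auto simp: A_def)
    have le: "nrm (A x) \<le> (1/2) * nrm x" if "x \<in> X" for x
    proof -
      have "nrm (A x) \<le> cmod (1 / L) * nrm (T x)"
        unfolding A_def using nrm_scale bounded_op_mem[OF T that] by blast
      also have "\<dots> \<le> cmod (1 / L) * (C * nrm x)" using C(2) that by (intro mult_left_mono) auto
      finally show ?thesis using C by (simp add: norm_divide Ln)
    qed
    have "y - A y = cscale (- 1 / L) (T y - cscale L y)"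
      using L0 by (simp add: A_def cseq.scale_right_diff_distrib)
    then have "y - A y \<in> M" using cseq.subspace_scale[OF D(1) yM] by (simp only:)
    moreover have "(\<lambda>k. nrm ((A ^^ k) y)) \<longlonglongrightarrow> 0"
      by (rule contraction_iterates_vanish[OF A _ _ le y]) auto
    ultimately show "y \<in> M" using mem_if_iterates_vanish[OF M A AM y] by blast
  qed
  moreover have "connected (- {0::complex})" by (rule connected_punctured_universe) simp
  moreover have "\<exists>B. openin (top_of_set (- {0})) B \<and> a \<in> B \<and>
      (\<forall>m\<in>B. \<forall>m'\<in>B. absorbs p T M m \<longrightarrow> absorbs p T M m')" if a: "a \<in> - {0}" for a
  proof -
    obtain S where S: "inverse_at T a S" using ex a by auto
    obtain C where C: "0 < C" "\<And>x. x \<in> X \<Longrightarrow> nrm (S x) \<le> C * nrm x"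
      using bounded_op_bound[of S] S unfolding inverse_at_def by blast
    \<comment> \<open>Inverses at points of this ball are bounded by \<open>2 C\<close>, so the ball lies within the reach of
      \<open>absorbs_nearby\<close> both from the centre outwards and from each point back to the centre.\<close>
    define B where "B = - {0} \<inter> ball a (1 / (2 * C))"
    have nearB: "cmod (m - a) * (2 * C) < 1" if "m \<in> B" for m
      using that C by (simp add: B_def dist_norm norm_minus_commute field_simps)
    have "absorbs p T M m'" if m: "m \<in> B" "m' \<in> B" "absorbs p T M m" for m m'
    proof -
      obtain R where R: "inverse_at T m R" using ex m by (auto simp: B_def)
      have "absorbs p T M a"
      proof (rule absorbs_nearby[OF T M R _ _ _ m(3)])
        show "nrm (R x) \<le> (2 * C) * nrm x" if "x \<in> X" for x
          by (rule inverse_at_nearby_bound[OF T S C(2,1) R nearB[OF m(1)] that])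
        show "cmod (a - m) * (2 * C) < 1" using nearB[OF m(1)] by (simp add: norm_minus_commute)
      qed (use C in auto)
      moreover have "cmod (m' - a) * C < 1"
        using nearB[OF m(2)] C mult_nonneg_nonneg[of "cmod (m' - a)" C] by linarith
      ultimately show ?thesis using absorbs_nearby[OF T M S C] by blast
    qed
    moreover have "openin (top_of_set (- {0})) B" unfolding B_def by (rule openin_open_Int) simp
    moreover have "a \<in> B" using a C by (simp add: B_def)
    ultimately show ?thesis by blast
  qed
  ultimately show ?thesis
    using connected_induction_simple[of "- {0}" L l "absorbs p T M"] L0 l by auto
qed

section \<open>Cancelling polynomials; Krylov subspaces\<close>

lemma op_poly_0: "op_poly T 0 y = 0"
  by (simp add: op_poly_def)

lemma op_poly_pCons:
  assumes T: "bounded_op p T"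
  shows "op_poly T (pCons a U) y = cscale a y + T (op_poly T U y)"
  by (cases "a = 0 \<and> U = 0") (auto simp: op_poly_def bounded_op_zero[OF T])

lemma bounded_op_poly: "bounded_op p T \<Longrightarrow> bounded_op p (op_poly T U)"
proof (induction U)
  case 0
  have "op_poly T 0 = (\<lambda>_. 0)" using op_poly_0 by (rule ext)
  then show ?case using bounded_op_null by (simp only:)
next
  case (pCons a U)
  have "op_poly T (pCons a U) = (\<lambda>y. cscale a y + T (op_poly T U y))"
    using op_poly_pCons[OF pCons.prems] by (rule ext)
  then show ?case using bounded_op_Horner[OF pCons.prems pCons.IH[OF pCons.prems]] by (simp only:)
qed

lemma op_poly_add:
  assumes T: "bounded_op p T" and y: "y \<in> X"
  shows "op_poly T (U + V) y = op_poly T U y + op_poly T V y"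
proof (induction U V rule: poly_induct2)
  case 0
  show ?case by (simp only: op_poly_0 add_0)
next
  case (pCons a U b V)
  have "T (op_poly T (U + V) y) = T (op_poly T U y) + T (op_poly T V y)"
    by (simp only: pCons bounded_op_add[OF T] bounded_op_mem[OF bounded_op_poly[OF T] y])
  then show ?case
    by (simp only: add_pCons op_poly_pCons[OF T] cseq.scale_left_distrib ac_simps)
qed

lemma op_poly_smult:
  assumes T: "bounded_op p T" and y: "y \<in> X"
  shows "op_poly T (smult c U) y = cscale c (op_poly T U y)"
proof (induction U)
  case 0
  show ?case by (simp only: smult_0_right op_poly_0 cseq.scale_zero_right)
next
  case (pCons a U)
  have "T (op_poly T (smult c U) y) = cscale c (T (op_poly T U y))"
    by (simp only: pCons bounded_op_scale[OF T] bounded_op_mem[OF bounded_op_poly[OF T] y])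
  then show ?case
    by (simp only: smult_pCons op_poly_pCons[OF T] cseq.scale_right_distrib cseq.scale_scale)
qed

lemma op_poly_linear_factor:
  assumes T: "bounded_op p T" and y: "y \<in> X"
  shows "op_poly T ([:- l, 1:] * V) y = T (op_poly T V y) - cscale l (op_poly T V y)"
proof -
  have "[:- l, 1:] * V = smult (- l) V + pCons 0 V" by simp
  then show ?thesis
    by (simp only: op_poly_add[OF T y] op_poly_smult[OF T y] op_poly_pCons[OF T]
        cseq.scale_minus_left cseq.scale_zero_left add_0 uminus_add_conv_diff)
qed

lemma op_poly_apply:
  assumes T: "bounded_op p T" and y: "y \<in> X"
  shows "op_poly T U (T y) = T (op_poly T U y)"
proof (induction U)
  case 0
  show ?case by (simp only: op_poly_0 bounded_op_zero[OF T])
next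
  case (pCons a U)
  have "T (cscale a y + T (op_poly T U y)) = cscale a (T y) + T (T (op_poly T U y))"
    by (simp only: bounded_op_add[OF T] bounded_op_scale[OF T] X_scale y
        bounded_op_mem[OF T] bounded_op_mem[OF bounded_op_poly[OF T] y])
  then show ?case by (simp only: op_poly_pCons[OF T] pCons)
qed

text \<open>Linear factors of \<open>U\<close> are cancelled one at a time. As \<open>U(0) \<noteq> 0\<close>, no factor has the root \<open>0\<close>.\<close>

lemma cancel_op_poly:
  assumes T: "bounded_op p T" and M: "closed_subspace p M" and ab: "\<And>l. l \<noteq> 0 \<Longrightarrow> absorbs p T M l"
    and y: "y \<in> X"
  shows "coeff U 0 \<noteq> 0 \<Longrightarrow> op_poly T U y \<in> M \<Longrightarrow> y \<in> M"
proof (induction "degree U" arbitrary: U)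
  case 0
  then obtain c where c: "U = [:c:]" "c \<noteq> 0" by (metis degree_eq_zeroE coeff_pCons_0)
  then have "cscale c y \<in> M" using 0
    by (simp only: op_poly_pCons[OF T] op_poly_0 bounded_op_zero[OF T] add_0_right)
  from cseq.subspace_scale[OF closed_subspaceD(1)[OF M] this, of "1 / c"] c show ?case by simp
next
  case (Suc n)
  have "\<not> constant (poly U)" using Suc.hyps(2) by (simp add: constant_degree)
  then obtain l where l: "poly U l = 0" using fundamental_theorem_of_algebra by blast
  then obtain V where V: "U = [:- l, 1:] * V" by (auto simp: poly_eq_0_iff_dvd)
  have l0: "l \<noteq> 0" using l Suc.prems(1) by (auto simp: poly_0_coeff_0)
  have V0: "V \<noteq> 0" using Suc.prems(1) V by auto
  have "degree U = degree [:- l, 1:] + degree V" unfolding V by (rule degree_mult_eq) (use V0 in auto)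
  then have "n = degree V" using Suc.hyps(2) by simp
  moreover have "coeff V 0 \<noteq> 0" using Suc.prems(1) by (auto simp: V)
  moreover have "op_poly T V y \<in> M"
    using Suc.prems(2) ab[OF l0] bounded_op_mem[OF bounded_op_poly[OF T] y]
    unfolding V op_poly_linear_factor[OF T y] absorbs_def by blast
  ultimately show ?case using Suc.hyps(1) by blast
qed

definition krylov where "krylov T x = range (\<lambda>U. op_poly T U x)"

lemma krylov_eq_span:
  assumes T: "bounded_op p T" and x: "x \<in> X"
  shows "krylov T x = cseq.span {(T ^^ n) x |n. True}"
proof
  have "op_poly T U x \<in> cseq.span {(T ^^ n) x |n. True}" for U
  proof -
    let ?K = "cseq.span {(T ^^ n) x |n. True}"
    have inv: "y \<in> X \<and> T y \<in> ?K" if "y \<in> ?K" for y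
      using that
    proof (induction rule: cseq.span_induct_alt)
      case base
      show ?case using cseq.span_zero X_zero by (simp only: bounded_op_zero[OF T])
    next
      case (step c z y)
      then obtain n where n: "z = (T ^^ n) x" by blast
      have zX: "z \<in> X" unfolding n by (induction n) (auto simp: x bounded_op_mem[OF T])
      have "T z = (T ^^ Suc n) x" using n by simp
      then have Tz: "T z \<in> ?K" by (intro cseq.span_base) blast
      have "T (cscale c z + y) = cscale c (T z) + T y"
        using step.IH zX by (simp add: bounded_op_add[OF T] bounded_op_scale[OF T] X_scale)
      then have "T (cscale c z + y) \<in> ?K"
        using cseq.span_add[OF cseq.span_scale[OF Tz]] step.IH by simp
      moreover have "cscale c z + y \<in> X" using X_add[OF X_scale[OF zX]] step.IH by blast
      ultimately show ?case by blast
    qed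
    have "x = (T ^^ 0) x" by simp
    then have xs: "x \<in> ?K" by (intro cseq.span_base) blast
    show ?thesis
    proof (induction U)
      case 0
      show ?case using cseq.span_zero by (simp only: op_poly_0)
    next
      case (pCons a U)
      show ?case
        using cseq.span_add[OF cseq.span_scale[OF xs]] inv[OF pCons(2)]
        by (simp only: op_poly_pCons[OF T])
    qed
  qed
  then show "krylov T x \<subseteq> cseq.span {(T ^^ n) x |n. True}" by (auto simp: krylov_def)
  have "cseq.subspace (krylov T x)"
    unfolding krylov_def
    by (rule cseq.subspaceI)
       (auto simp: op_poly_add[OF T x, symmetric] op_poly_smult[OF T x, symmetric] op_poly_0[of T x, symmetric])
  moreover have "(T ^^ n) x = op_poly T (monom 1 n) x" for n
    by (induction n) (simp_all add: monom_0 monom_Suc op_poly_pCons[OF T] op_poly_0 bounded_op_zero[OF T])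
  ultimately show "cseq.span {(T ^^ n) x |n. True} \<subseteq> krylov T x"
    by (intro cseq.span_minimal) (auto simp: krylov_def)
qed

section \<open>Norm estimates and density of the basis\<close>

text \<open>The inclusion of \<open>\<ell>\<^sub>1(\<int>)\<close> in the space does not increase the norm. For finite exponent \<open>r\<close> this
  follows from \<open>t\<^sup>r \<le> t\<close> with \<open>t = \<bar>x\<^sub>k\<bar> / s \<le> 1\<close>.\<close>

lemma norm_le_summable_majorant:
  fixes x :: "int \<Rightarrow> complex"
  assumes g: "(g has_sum s) UNIV" and le: "\<And>k. cmod (x k) \<le> g k"
  shows "x \<in> X \<and> nrm x \<le> s"
proof -
  have g0: "0 \<le> g k" for k using le[of k] norm_ge_zero order_trans by blast
  have sg: "g summable_on UNIV" and ig: "infsum g UNIV = s"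
    using g by (auto simp: summable_on_def infsumI)
  have part: "sum g F \<le> s" if "finite F" for F
    using finite_sum_le_infsum[OF sg that] g0 ig by simp
  have xs: "cmod (x k) \<le> s" for k
    using part[of "{k}"] le[of k] by simp
  show ?thesis
  proof (cases "p = \<infinity>")
    case True
    have "finite {k. \<not> cmod (x k) < e}" if e: "0 < e" for e
    proof (rule ccontr)
      assume "infinite {k. \<not> cmod (x k) < e}"
      moreover obtain N :: nat where N: "s < real N * e" using ex_less_of_nat_mult[OF e] by blast
      ultimately obtain F where F: "F \<subseteq> {k. \<not> cmod (x k) < e}" "finite F" "card F = N"
        by (metis infinite_arbitrarily_large)
      have "real N * e = (\<Sum>k\<in>F. e)" using F by simp
      also have "\<dots> \<le> sum g F" using F(1) le by (intro sum_mono) (force intro: order_trans[rotated])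
      finally show False using part[OF F(2)] N by simp
    qed
    then have "(x \<longlongrightarrow> 0) cofinite"
      by (auto simp: tendsto_iff eventually_cofinite)
    then show ?thesis using True xs by (auto simp: seq_space_def seq_norm_def intro: cSUP_least)
  next
    case False
    define r where "r = real_of_ereal p"
    have r: "1 \<le> r" using real_p[OF p False] r_def by simp
    show ?thesis
    proof (cases "s = 0")
      case True
      then have "x = 0" using xs by (auto simp: fun_eq_iff)
      then show ?thesis using True X_zero nrm_zero by (simp only: order_refl simp_thms)
    next
      case s0: False
      have "0 \<le> s" using xs[of 0] norm_ge_zero order_trans by blast
      then have s: "0 < s" using s0 by simp
      have b: "cmod (x k) powr r \<le> s powr r / s * g k" for k
      proof -
        let ?t = "cmod (x k) / s"
        have t: "0 \<le> ?t" "?t \<le> 1" using xs[of k] s by auto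
        have "?t powr r \<le> ?t"
          using powr_mono'[of 1 r ?t] t r by (cases "?t = 0") auto
        then have "s powr r * ?t powr r \<le> s powr r * ?t" by (intro mult_left_mono) auto
        moreover have "s powr r * ?t powr r = cmod (x k) powr r"
          using s by (simp add: powr_divide)
        moreover have "s powr r * ?t \<le> s powr r / s * g k"
          using le[of k] s by (simp add: field_simps mult_left_mono)
        ultimately show ?thesis by linarith
      qed
      have sum_b: "(\<lambda>k. s powr r / s * g k) summable_on UNIV"
        by (intro summable_on_cmult_right sg)
      have sx: "(\<lambda>k. cmod (x k) powr r) summable_on UNIV"
        by (rule summable_on_comparison_test[OF sum_b]) (use b in auto)
      have "(\<Sum>\<^sub>\<infinity>k. cmod (x k) powr r) \<le> (\<Sum>\<^sub>\<infinity>k. s powr r / s * g k)"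
        by (intro infsum_mono sx sum_b b)
      also have "\<dots> = s powr r" using s by (simp only: infsum_cmult_right' ig) simp
      finally have "(\<Sum>\<^sub>\<infinity>k. cmod (x k) powr r) powr (1 / r) \<le> (s powr r) powr (1 / r)"
        using r by (intro powr_mono2) (auto simp: infsum_nonneg)
      also have "\<dots> = s" using r s by (simp add: powr_powr)
      finally show ?thesis using sx False by (simp add: seq_space_def seq_norm_def r_def)
    qed
  qed
qed

lemma canon_basis_unit: "canon_basis n \<in> X" "nrm (canon_basis n) \<le> 1"
proof -
  have "((\<lambda>k. if k = n then 1 else 0 :: real) has_sum 1) {n}"
    by (rule has_sum_finiteI) auto
  then have "((\<lambda>k. if k = n then 1 else 0 :: real) has_sum 1) UNIV"
    by (subst has_sum_cong_neutral[where T = "{n}" and g = "\<lambda>k. if k = n then 1 else 0"]) auto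
  then have "canon_basis n \<in> X \<and> nrm (canon_basis n) \<le> 1"
    by (rule norm_le_summable_majorant) (auto simp: canon_basis_def)
  then show "canon_basis n \<in> X" "nrm (canon_basis n) \<le> 1" by auto
qed

lemma finite_truncation:
  assumes y: "y \<in> X" and e: "0 < e"
  shows "\<exists>F. finite F \<and> nrm (\<lambda>k. if k \<in> F then 0 else y k) < e"
proof (cases "p = \<infinity>")
  case True
  let ?F = "{k. \<not> cmod (y k) < e / 2}"
  have "finite ?F"
    using y True e tendstoD[of y 0 cofinite "e / 2"] by (simp add: seq_space_def eventually_cofinite)
  moreover have "(SUP k. cmod (if k \<in> ?F then 0 else y k)) \<le> e / 2"
    using e by (intro cSUP_least) auto
  ultimately show ?thesis using e True by (intro exI[of _ ?F]) (simp add: seq_norm_def)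
next
  case False
  define r where "r = real_of_ereal p"
  have r: "1 \<le> r" using real_p[OF p False] r_def by simp
  define f where "f = (\<lambda>k. cmod (y k) powr r)"
  have f: "f summable_on UNIV" using y False by (simp add: seq_space_def r_def f_def)
  have "0 < (e / 2) powr r" using e by simp
  then obtain F where F: "finite F" "dist (sum f F) (infsum f UNIV) \<le> (e / 2) powr r"
    using infsum_finite_approximation[OF f] by blast
  have "(\<Sum>\<^sub>\<infinity>k. cmod (if k \<in> F then 0 else y k) powr r) = infsum f (UNIV - F)"
    by (rule infsum_cong_neutral) (auto simp: f_def)
  also have "\<dots> = infsum f UNIV - sum f F"
    using infsum_Diff[OF f, of F] F(1) by simp
  also have "\<dots> \<le> (e / 2) powr r" using F(2) by (simp add: dist_real_def)
  finally have "(\<Sum>\<^sub>\<infinity>k. cmod (if k \<in> F then 0 else y k) powr r) powr (1 / r) \<le> ((e / 2) powr r) powr (1 / r)"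
    using r by (intro powr_mono2) (auto simp: infsum_nonneg)
  also have "\<dots> < e" using r e by (simp add: powr_powr)
  finally show ?thesis using False F(1) by (intro exI[of _ F]) (simp add: seq_norm_def r_def)
qed

lemma closed_subspace_with_basis:
  assumes M: "closed_subspace p M" and basis: "\<And>j. canon_basis j \<in> M"
  shows "M = X"
proof
  note D = closed_subspaceD[OF M]
  show "M \<subseteq> X" by (rule D(2))
  show "X \<subseteq> M"
  proof
    fix y assume y: "y \<in> X"
    have fin: "(\<lambda>k. if k \<in> F then y k else 0) \<in> M" if "finite F" for F
      using that
    proof (induction F rule: finite_induct)
      case empty
      show ?case using cseq.subspace_0[OF D(1)] by (simp add: zero_fun_def)
    next
      case (insert j F)
      have "cscale (y j) (canon_basis j) + (\<lambda>k. if k \<in> F then y k else 0)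
          = (\<lambda>k. if k \<in> insert j F then y k else 0)"
        using insert.hyps by (auto simp: cscale_def canon_basis_def fun_eq_iff)
      then show ?case
        using cseq.subspace_add[OF D(1) cseq.subspace_scale[OF D(1) basis] insert.IH, of "y j" j]
        by (simp only:)
    qed
    show "y \<in> M"
    proof (rule D(3)[OF y])
      fix e :: real assume "0 < e"
      then obtain F where F: "finite F" "nrm (\<lambda>k. if k \<in> F then 0 else y k) < e"
        using finite_truncation[OF y] by blast
      have "y - (\<lambda>k. if k \<in> F then y k else 0) = (\<lambda>k. if k \<in> F then 0 else y k)"
        by (auto simp: fun_eq_iff)
      then have "nrm (y - (\<lambda>k. if k \<in> F then y k else 0)) < e" using F(2) by (simp only:)
      then show "\<exists>z\<in>M. nrm (y - z) < e" using fin[OF F(1)] by blast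
    qed
  qed
qed

section \<open>Compact weighted shifts\<close>

lemma iterate_weighted_shift:
  "(weighted_shift w ^^ k) x n = (\<Prod>i\<in>{n + 1..n + int k}. w i) * x (n + int k)"
proof (induction k arbitrary: n)
  case 0
  show ?case by simp
next
  case (Suc k)
  have "(weighted_shift w ^^ Suc k) x n = w (n + 1) * (weighted_shift w ^^ k) x (n + 1)"
    by (simp add: weighted_shift_def[of w "(weighted_shift w ^^ k) x"])
  also have "\<dots> = w (n + 1) * (\<Prod>i\<in>{n + 2..n + int (Suc k)}. w i) * x (n + int (Suc k))"
    by (simp add: Suc add.assoc)
  also have "{n + 1..n + int (Suc k)} = insert (n + 1) {n + 2..n + int (Suc k)}" by auto
  then have "w (n + 1) * (\<Prod>i\<in>{n + 2..n + int (Suc k)}. w i) = (\<Prod>i\<in>{n + 1..n + int (Suc k)}. w i)"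
    by simp
  finally show ?case .
qed

text \<open>A product of \<open>k\<close> distinct weights contains each large weight at most once, so it is at most a
  constant times \<open>2\<^sup>-\<^sup>k\<close>.\<close>

lemma iterates_vanish_if_few_large_weights:
  assumes u: "bounded (range u)" and B: "finite {n. 1 / 2 \<le> cmod (u n)}" and y: "y \<in> X"
  shows "(\<lambda>k. nrm ((weighted_shift u ^^ k) y)) \<longlonglongrightarrow> 0"
proof -
  let ?B = "{n. 1 / 2 \<le> cmod (u n)}"
  obtain C0 where C0: "\<And>k. cmod (u k) \<le> C0" using u by (auto simp: bounded_iff)
  define C where "C = max (1/2) C0"
  have C: "1 / 2 \<le> C" "\<And>k. cmod (u k) \<le> C" using C0 by (auto simp: C_def intro: max.coboundedI2)
  define D where "D = (2 * C) ^ card ?B"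
  have prodb: "cmod (\<Prod>i\<in>I. u i) \<le> D * (1/2) ^ card I" if I: "finite I" for I
  proof -
    have "cmod (\<Prod>i\<in>I. u i) = (\<Prod>i\<in>I. cmod (u i))" by (rule prod_norm[symmetric])
    also have "\<dots> \<le> (\<Prod>i\<in>I. (if i \<in> ?B then 2 * C else 1) * (1/2))"
      using C by (intro prod_mono) (auto simp: not_le less_imp_le)
    also have "\<dots> = (\<Prod>i\<in>I. if i \<in> ?B then 2 * C else 1) * (1/2) ^ card I"
      by (simp only: prod.distrib prod_constant)
    also have "(\<Prod>i\<in>I. if i \<in> ?B then 2 * C else 1) = (2 * C) ^ card (I \<inter> ?B)"
      using I by (simp add: prod.If_cases)
    also have "(2 * C) ^ card (I \<inter> ?B) * (1/2) ^ card I \<le> D * (1/2) ^ card I"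
      unfolding D_def using C B by (intro mult_right_mono power_increasing card_mono) auto
    finally show ?thesis .
  qed
  have yX: "(weighted_shift u ^^ k) y \<in> X \<and> nrm ((weighted_shift u ^^ k) y) \<le> D * (1/2) ^ k * nrm y" for k
  proof -
    let ?v = "\<lambda>n. \<Prod>i\<in>{n - int k + 1..n}. u i"
    have "cmod (?v n) \<le> D * (1/2) ^ k" for n
      using prodb[of "{n - int k + 1..n}"] by simp
    from seq_space_mult_shift[OF p y this, where m = "int k"]
    have "(\<lambda>n. ?v (n + int k) * y (n + int k)) \<in> X \<and>
        nrm (\<lambda>n. ?v (n + int k) * y (n + int k)) \<le> D * (1/2) ^ k * nrm y" .
    moreover have "(\<lambda>n. ?v (n + int k) * y (n + int k)) = (weighted_shift u ^^ k) y"
      by (simp add: iterate_weighted_shift fun_eq_iff)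
    ultimately show ?thesis by (simp only:)
  qed
  have "(\<lambda>k. D * (1/2) ^ k * nrm y) \<longlonglongrightarrow> D * 0 * nrm y"
    by (intro tendsto_mult LIMSEQ_power_zero tendsto_const) auto
  then have "(\<lambda>k. D * (1/2) ^ k * nrm y) \<longlonglongrightarrow> 0" by simp
  moreover have "\<forall>k. norm (nrm ((weighted_shift u ^^ k) y)) \<le> D * (1/2) ^ k * nrm y"
    using yX seq_norm_nonneg[OF p] by simp
  ultimately show ?thesis by (rule Lim_null_comparison[OF always_eventually, rotated])
qed

text \<open>The \<open>T e\<^sub>n\<close> with \<open>\<bar>w\<^sub>n\<bar> \<ge> e\<close> have pairwise distance at least \<open>e\<close>, so no two of them fit in one of the
  finitely many balls of radius \<open>e / 2\<close> that cover the image of the unit ball.\<close>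

lemma compact_shift_weights_vanish:
  assumes T: "compact_op p (weighted_shift w)" and e: "0 < e"
  shows "finite {n. e \<le> cmod (w n)}"
proof -
  interpret Metric_space X "seq_dist p" using Metric_space_seq[OF p] .
  let ?K = "weighted_shift w ` {x \<in> X. nrm x \<le> 1}"
  have bT: "bounded_op p (weighted_shift w)" using T by (simp add: compact_op_def)
  have KX: "?K \<subseteq> X" using bounded_op_mem[OF bT] by auto
  have "mtotally_bounded (mtopology closure_of ?K)"
    using T by (intro compactin_imp_mtotally_bounded) (simp add: compact_op_def seq_top_def)
  then have "mtotally_bounded ?K"
    by (rule mtotally_bounded_subset) (use KX in \<open>simp add: closure_of_subset\<close>)
  then obtain F where F: "finite F" "?K \<subseteq> (\<Union>x\<in>F. mball x (e / 2))"
    unfolding mtotally_bounded_def using e by (meson half_gt_zero)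
  have K: "weighted_shift w (canon_basis n) \<in> ?K" for n
    using canon_basis_unit by blast
  have "\<exists>c\<in>F. weighted_shift w (canon_basis n) \<in> mball c (e / 2)" for n
    using subsetD[OF F(2) K] by blast
  then obtain c where c: "\<And>n. c n \<in> F" "\<And>n. weighted_shift w (canon_basis n) \<in> mball (c n) (e / 2)"
    by metis
  have "inj_on c {n. e \<le> cmod (w n)}"
  proof (rule inj_onI, rule ccontr)
    fix n m assume n: "n \<in> {n. e \<le> cmod (w n)}" and eq: "c n = c m" and ne: "n \<noteq> m"
    let ?a = "weighted_shift w (canon_basis n)" and ?b = "weighted_shift w (canon_basis m)"
    have ab: "?a \<in> X" "?b \<in> X" using K KX by blast+
    have "c n \<in> X" using c(2)[of n] by (simp add: in_mball)
    then have "seq_dist p ?a ?b \<le> seq_dist p ?a (c n) + seq_dist p (c n) ?b"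
      using ab by (intro triangle)
    also have "\<dots> < e" using c(2)[of n] c(2)[of m] eq commute by (auto simp: in_mball)
    finally have "nrm (?a - ?b) < e" using X_diff[OF ab] by (simp add: seq_dist_def)
    moreover have "cmod ((?a - ?b) (n - 1)) \<le> nrm (?a - ?b)"
      by (rule cmod_le_seq_norm[OF p X_diff[OF ab]])
    moreover have "(?a - ?b) (n - 1) = w n"
      using ne by (simp add: weighted_shift_def canon_basis_def)
    ultimately show False using n by simp
  qed
  then show ?thesis by (rule inj_on_finite[OF _ _ F(1)]) (use c(1) in auto)
qed

text \<open>Dividing the weights by \<open>l\<close> turns \<open>T / l\<close> into a weighted shift with only finitely many weights of
  modulus at least \<open>1 / 2\<close>.\<close>

lemma compact_shift_absorbs:
  assumes w: "bounded (range w)" and T: "compact_op p (weighted_shift w)"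
    and M: "closed_subspace p M" and TM: "weighted_shift w ` M \<subseteq> M" and l: "l \<noteq> 0"
  shows "absorbs p (weighted_shift w) M l"
  unfolding absorbs_def
proof (intro ballI impI)
  note D = closed_subspaceD[OF M]
  let ?T = "weighted_shift w"
  fix y assume y: "y \<in> X" and yM: "?T y - cscale l y \<in> M"
  define u where "u = (\<lambda>n. w n / l)"
  have A: "weighted_shift u x = cscale (1 / l) (?T x)" for x
    by (simp add: weighted_shift_def cscale_def u_def fun_eq_iff)
  obtain C where "\<And>k. cmod (w k) \<le> C" using w by (auto simp: bounded_iff)
  then have "\<forall>x\<in>range u. cmod x \<le> C / cmod l"
    by (auto simp: u_def norm_divide divide_right_mono)
  then have u: "bounded (range u)" unfolding bounded_iff by blast
  have AM: "weighted_shift u ` M \<subseteq> M"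
    using TM cseq.subspace_scale[OF D(1)] by (auto simp: A)
  have "y - weighted_shift u y = cscale (- 1 / l) (?T y - cscale l y)"
    using l by (simp add: A cscale_def fun_eq_iff field_simps)
  then have "y - weighted_shift u y \<in> M" using cseq.subspace_scale[OF D(1) yM] by (simp only:)
  moreover have "{n. 1 / 2 \<le> cmod (u n)} = {n. cmod l / 2 \<le> cmod (w n)}"
    using l by (auto simp: u_def norm_divide field_simps)
  then have "finite {n. 1 / 2 \<le> cmod (u n)}"
    using compact_shift_weights_vanish[OF T, of "cmod l / 2"] l by simp
  ultimately show "y \<in> M"
    using mem_if_iterates_vanish[OF M bounded_op_weighted_shift[OF p u] AM y]
      iterates_vanish_if_few_large_weights[OF u _ y] by blast
qed

section \<open>Construction of a cyclic vector\<close>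

lemma krylov_subspace:
  assumes T: "bounded_op p T" and x: "x \<in> X"
  shows "cseq.subspace (krylov T x)" "krylov T x \<subseteq> X" "T ` krylov T x \<subseteq> krylov T x" "x \<in> krylov T x"
proof -
  show "cseq.subspace (krylov T x)"
    unfolding krylov_eq_span[OF T x] by (rule cseq.subspace_span)
  show "krylov T x \<subseteq> X"
    using bounded_op_mem[OF bounded_op_poly[OF T] x] by (auto simp: krylov_def)
  have "T (op_poly T U x) = op_poly T (pCons 0 U) x" for U
    by (simp add: op_poly_pCons[OF T])
  then show "T ` krylov T x \<subseteq> krylov T x" by (auto simp: krylov_def)
  have "op_poly T 1 x = x"
    by (simp add: one_pCons op_poly_pCons[OF T] op_poly_0 bounded_op_zero[OF T])
  then show "x \<in> krylov T x" unfolding krylov_def by (metis rangeI)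
qed

text \<open>A polynomial \<open>U\<close> with \<open>U(T) v\<close> close to \<open>y\<close> is fixed first; \<open>U(T)\<close> is continuous, so the same \<open>U\<close>
  serves all \<open>x\<close> near \<open>v\<close>.\<close>

lemma krylov_approximation_stable:
  assumes T: "bounded_op p T" and v: "v \<in> X" and e: "0 < e" and J: "finite J"
    and cl: "J \<subseteq> seq_top p closure_of (krylov T v)"
  shows "\<exists>d>0. \<forall>x\<in>X. nrm (x - v) \<le> d \<longrightarrow> (\<forall>y\<in>J. \<exists>z\<in>krylov T x. nrm (y - z) < e)"
  using J cl
proof (induction J rule: finite_induct)
  case empty
  show ?case by (auto intro: exI[of _ 1])
next
  case (insert y J)
  then obtain d where d: "0 < d"
    "\<And>x. x \<in> X \<Longrightarrow> nrm (x - v) \<le> d \<Longrightarrow> (\<forall>y\<in>J. \<exists>z\<in>krylov T x. nrm (y - z) < e)"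
    using insert.IH insert.prems by blast
  have y: "y \<in> X" "\<exists>z\<in>krylov T v. nrm (y - z) < e"
    using insert.prems e mem_closure_seq_top[OF krylov_subspace(2)[OF T v], of y] by auto
  then obtain U where U: "nrm (y - op_poly T U v) < e" by (auto simp: krylov_def)
  note Q = bounded_op_poly[OF T, of U]
  obtain C where C: "0 < C" "\<And>x. x \<in> X \<Longrightarrow> nrm (op_poly T U x) \<le> C * nrm x"
    using bounded_op_bound[OF Q] by blast
  define d' where "d' = (e - nrm (y - op_poly T U v)) / (2 * C)"
  have d': "0 < d'" using U C by (simp add: d'_def)
  have "\<exists>z\<in>krylov T x. nrm (y - z) < e" if x: "x \<in> X" and xv: "nrm (x - v) \<le> d'" for x
  proof -
    have "nrm (op_poly T U v - op_poly T U x) = nrm (op_poly T U (x - v))"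
      using seq_norm_minus_commute[OF p, of "op_poly T U v"] by (simp add: bounded_op_diff[OF Q x v])
    also have "\<dots> \<le> C * nrm (x - v)" by (rule C(2)[OF X_diff[OF x v]])
    also have "\<dots> \<le> C * d'" using xv C by simp
    also have "\<dots> < e - nrm (y - op_poly T U v)" using U C by (simp add: d'_def)
    finally have "nrm (op_poly T U v - op_poly T U x) < e - nrm (y - op_poly T U v)" .
    moreover have "nrm (y - op_poly T U x)
        \<le> nrm (y - op_poly T U v) + nrm (op_poly T U v - op_poly T U x)"
      by (intro nrm_triangle y bounded_op_mem[OF Q] x v)
    ultimately have "nrm (y - op_poly T U x) < e" by linarith
    then show ?thesis by (auto simp: krylov_def)
  qed
  then have "\<forall>x\<in>X. nrm (x - v) \<le> min d d' \<longrightarrow>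
      (\<forall>y\<in>insert y J. \<exists>z\<in>krylov T x. nrm (y - z) < e)"
    using d(2) by simp
  moreover have "0 < min d d'" using d(1) d' by simp
  ultimately show ?case by blast
qed

text \<open>Cancelling \<open>U(T)\<close> yields \<open>e\<^sub>m\<close> itself, and applying \<open>T\<close> repeatedly to \<open>e\<^sub>m\<close> reaches the lower indices.\<close>

lemma basis_in_krylov_closure:
  assumes w: "bounded (range w)" and nz: "\<And>n. w n \<noteq> 0"
    and ab: "\<And>M l. closed_subspace p M \<Longrightarrow> weighted_shift w ` M \<subseteq> M \<Longrightarrow> l \<noteq> 0 \<Longrightarrow>
               absorbs p (weighted_shift w) M l"
    and U: "coeff U 0 \<noteq> 0" and v: "v = op_poly (weighted_shift w) U (canon_basis m)"
    and jm: "j \<le> m"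
  shows "canon_basis j \<in> seq_top p closure_of (krylov (weighted_shift w) v)"
proof -
  let ?T = "weighted_shift w"
  have T: "bounded_op p ?T" by (rule bounded_op_weighted_shift[OF p w])
  have vX: "v \<in> X" unfolding v by (rule bounded_op_mem[OF bounded_op_poly[OF T] canon_basis_unit(1)])
  note K = krylov_subspace[OF T vX]
  let ?M = "seq_top p closure_of (krylov ?T v)"
  have M: "closed_subspace p ?M" by (rule closed_subspace_closure[OF K(1,2)])
  have TM: "?T ` ?M \<subseteq> ?M" by (rule closure_invariant[OF T K(2,3)])
  have "v \<in> ?M"
    using mem_closure_seq_top[OF K(2)] vX K(4) nrm_zero by (auto intro!: bexI[of _ v])
  then have base: "canon_basis m \<in> ?M"
    using cancel_op_poly[OF T M ab[OF M TM] canon_basis_unit(1) U] v by blast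
  show ?thesis
    using jm
  proof (induction j rule: int_le_induct)
    case base
    show ?case by fact
  next
    case (step i)
    have "canon_basis (i - 1) = cscale (1 / w i) (?T (canon_basis i))"
      using nz[of i] by (simp add: weighted_shift_canon_basis cscale_def)
    then show ?case
      using cseq.subspace_scale[OF closed_subspaceD(1)[OF M]] TM step.IH by auto
  qed
qed

text \<open>The tails of the vector built in \<open>cyclic_if_absorbs\<close>: its coefficient at \<open>n + 1\<close> is half the
  tolerance \<open>d n\<close> that step \<open>n\<close> leaves for all later changes. As the tolerances at least halve, the
  tail beyond \<open>N\<close> sums to at most \<open>d N / 2 + d N / 4 + \<dots> = d N\<close>.\<close>

lemma norm_halving_tail:
  assumes d: "\<And>n. 0 < d n" "\<And>n. d (Suc n) \<le> d n / 2"
  defines "t \<equiv> \<lambda>N k. if int N < k then complex_of_real (d (nat (k - 1)) / 2) else 0"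
  shows "t N \<in> X \<and> nrm (t N) \<le> d N"
proof -
  define g where "g = (\<lambda>k. if int N < k then d N * (1/2) ^ nat (k - int N) else 0)"
  have dec: "d (N + i) \<le> d N * (1/2) ^ i" for i
  proof (induction i)
    case (Suc i)
    have "d (N + Suc i) \<le> d (N + i) / 2" using d(2)[of "N + i"] by simp
    also have "\<dots> \<le> d N * (1/2) ^ i / 2" using Suc by simp
    finally show ?case by simp
  qed simp
  have "(\<lambda>i. (1/2::real) ^ Suc i) sums 1" by (rule power_half_series)
  from sums_mult[OF this, of "d N"] have "(\<lambda>i. d N * (1/2) ^ Suc i) sums d N" by simp
  then have "((\<lambda>i. d N * (1/2) ^ Suc i) has_sum d N) UNIV"
    by (intro sums_nonneg_imp_has_sum) (use d(1)[of N] in auto)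
  moreover have "d N * (1/2) ^ Suc i = g (int N + 1 + int i)" for i
    by (simp add: g_def nat_add_distrib)
  ultimately have "((g \<circ> (\<lambda>i. int N + 1 + int i)) has_sum d N) UNIV" by (simp add: o_def)
  then have "(g has_sum d N) (range (\<lambda>i. int N + 1 + int i))"
    by (subst has_sum_reindex) (auto simp: inj_on_def)
  moreover have "range (\<lambda>i. int N + 1 + int i) = {k. int N < k}"
  proof (intro equalityI subsetI)
    fix k assume "k \<in> {k. int N < k}"
    then have "k = int N + 1 + int (nat (k - int N - 1))" by simp
    then show "k \<in> range (\<lambda>i. int N + 1 + int i)" by blast
  qed auto
  ultimately have "(g has_sum d N) {k. int N < k}" by simp
  then have "(g has_sum d N) UNIV"
    by (subst has_sum_cong_neutral[where T = "{k. int N < k}" and g = g]) (auto simp: g_def)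
  moreover have "cmod (t N k) \<le> g k" for k
  proof (cases "int N < k")
    case True
    define i where "i = nat (k - int N - 1)"
    have k: "nat (k - 1) = N + i" "nat (k - int N) = Suc i" using True by (auto simp: i_def)
    have "cmod (t N k) = d (N + i) / 2" using True d(1)[of "N + i"] by (simp add: t_def k norm_divide)
    also have "\<dots> \<le> d N * (1/2) ^ i / 2" using dec by simp
    also have "\<dots> = g k" using True by (simp add: g_def k)
    finally show ?thesis .
  qed (simp add: t_def g_def)
  ultimately show ?thesis by (rule norm_le_summable_majorant)
qed

text \<open>Stage \<open>N\<close> consists of a vector \<open>v = U(T) e\<^sub>N\<close> with \<open>U(0) \<noteq> 0\<close> and a tolerance \<open>d\<close>: every \<open>x\<close> within
  \<open>d\<close> of \<open>v\<close> has polynomials in \<open>T\<close> that bring it close to \<open>e\<^sub>j\<close> for \<open>\<bar>j\<bar> \<le> N\<close>. The next vector adds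
  \<open>(d / 2) e\<^sub>N\<^sub>+\<^sub>1\<close>, and the next tolerance is at most \<open>d / 2\<close>, so the limit stays within the tolerance
  of every stage.\<close>

lemma cyclic_if_absorbs:
  assumes w: "bounded (range w)" and nz: "\<And>n. w n \<noteq> 0"
    and ab: "\<And>M l. closed_subspace p M \<Longrightarrow> weighted_shift w ` M \<subseteq> M \<Longrightarrow> l \<noteq> 0 \<Longrightarrow>
               absorbs p (weighted_shift w) M l"
  shows "cyclic_op p (weighted_shift w)"
proof -
  let ?T = "weighted_shift w"
  have T: "bounded_op p ?T" by (rule bounded_op_weighted_shift[OF p w])
  define near where "near N v d \<longleftrightarrow> (\<forall>x\<in>X. nrm (x - v) \<le> d \<longrightarrow>
      (\<forall>y\<in>canon_basis ` {- int N..int N}. \<exists>z\<in>krylov ?T x. nrm (y - z) < 1 / real (Suc N)))"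
    for N v and d :: real
  define gen where "gen N v \<longleftrightarrow> (\<exists>U. coeff U 0 \<noteq> 0 \<and> v = op_poly ?T U (canon_basis (int N)))" for N v
  have genX: "v \<in> X" if "gen N v" for N v
    using that bounded_op_mem[OF bounded_op_poly[OF T] canon_basis_unit(1)] by (auto simp: gen_def)
  have ex_near: "\<exists>d>0. near N v d" if "gen N v" for N v
    unfolding near_def
  proof (rule krylov_approximation_stable[OF T genX[OF that]])
    show "canon_basis ` {- int N..int N} \<subseteq> seq_top p closure_of (krylov ?T v)"
      using that basis_in_krylov_closure[OF w nz ab] by (auto simp: gen_def)
  qed auto
  define P where "P N s \<longleftrightarrow> gen N (fst s) \<and> 0 < snd s \<and> near N (fst s) (snd s)"
    for N and s :: "(int \<Rightarrow> complex) \<times> real"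
  define Q where "Q N s s' \<longleftrightarrow> snd s' \<le> snd s / 2 \<and>
      fst s' = fst s + cscale (complex_of_real (snd s / 2)) (canon_basis (int (Suc N)))"
    for N and s s' :: "(int \<Rightarrow> complex) \<times> real"
  have "\<exists>f. \<forall>N. P N (f N) \<and> Q N (f N) (f (Suc N))"
  proof (rule dependent_nat_choice)
    have "op_poly ?T 1 (canon_basis 0) = canon_basis 0"
      by (simp add: one_pCons op_poly_pCons[OF T] op_poly_0 bounded_op_zero[OF T])
    then have "gen 0 (canon_basis 0)" unfolding gen_def by (intro exI[of _ 1]) simp
    from ex_near[OF this] this show "\<exists>s. P 0 s" by (auto simp: P_def)
  next
    fix s N assume s: "P N s"
    then obtain U where U: "fst s = op_poly ?T U (canon_basis (int N))" by (auto simp: P_def gen_def)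
    let ?e = "canon_basis (int (Suc N))" and ?w = "w (int (Suc N))"
    define a where "a = complex_of_real (snd s / 2)"
    define v where "v = fst s + cscale a ?e"
    \<comment> \<open>The new polynomial is \<open>a + z U(z) / w\<^sub>N\<^sub>+\<^sub>1\<close>, because \<open>e\<^sub>N = T e\<^sub>N\<^sub>+\<^sub>1 / w\<^sub>N\<^sub>+\<^sub>1\<close>; its constant
      coefficient \<open>a\<close> is the coefficient of \<open>e\<^sub>N\<^sub>+\<^sub>1\<close> in the new vector.\<close>
    have eX: "?e \<in> X" by (rule canon_basis_unit(1))
    have "?T (op_poly ?T (smult (1 / ?w) U) ?e) = op_poly ?T (smult (1 / ?w) U) (?T ?e)"
      by (rule op_poly_apply[OF T eX, symmetric])
    also have "\<dots> = cscale (1 / ?w) (op_poly ?T U (cscale ?w (canon_basis (int N))))"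
      by (simp add: op_poly_smult[OF T] weighted_shift_canon_basis X_scale canon_basis_unit)
    also have "\<dots> = op_poly ?T U (canon_basis (int N))"
      using nz[of "int (Suc N)"]
      by (simp add: bounded_op_scale[OF bounded_op_poly[OF T]] canon_basis_unit)
    finally have "?T (op_poly ?T (smult (1 / ?w) U) ?e) = fst s" using U by simp
    then have "v = op_poly ?T (pCons a (smult (1 / ?w) U)) ?e"
      by (simp add: v_def op_poly_pCons[OF T] add.commute)
    moreover have "a \<noteq> 0" using s by (simp add: a_def P_def)
    ultimately have gen: "gen (Suc N) v"
      unfolding gen_def by (intro exI[of _ "pCons a (smult (1 / ?w) U)"]) simp
    then obtain d where d: "0 < d" "near (Suc N) v d" using ex_near by blast
    have "near (Suc N) v (min d (snd s / 2))" using d(2) by (simp add: near_def)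
    then have "P (Suc N) (v, min d (snd s / 2))" using gen d(1) s by (simp add: P_def)
    moreover have "Q N s (v, min d (snd s / 2))" by (simp add: Q_def v_def a_def)
    ultimately show "\<exists>s'. P (Suc N) s' \<and> Q N s s'" by blast
  qed
  then obtain f where f: "\<And>N. P N (f N)" "\<And>N. Q N (f N) (f (Suc N))" by blast
  define v d where "v N = fst (f N)" and "d N = snd (f N)" for N
  have vN: "v N \<in> X" "near N (v N) (d N)" "0 < d N" "d (Suc N) \<le> d N / 2"
    "v (Suc N) = v N + cscale (complex_of_real (d N / 2)) (canon_basis (int (Suc N)))" for N
    using f(1)[of N] f(2)[of N] genX[of N "fst (f N)"] by (auto simp: v_def d_def P_def Q_def)
  define t where "t = (\<lambda>N k. if int N < k then complex_of_real (d (nat (k - 1)) / 2) else 0)"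
  have t: "t N \<in> X" "nrm (t N) \<le> d N" for N
    using norm_halving_tail[of d, OF vN(3,4)] by (auto simp: t_def)
  define x where "x = v 0 + t 0"
  have xv: "x = v N + t N" for N
  proof (induction N)
    case 0
    show ?case by (rule x_def)
  next
    case (Suc N)
    have "t N = cscale (complex_of_real (d N / 2)) (canon_basis (int (Suc N))) + t (Suc N)"
    proof
      fix k
      consider "k \<le> int N" | "k = int (Suc N)" | "int (Suc N) < k" by linarith
      then show "t N k
          = (cscale (complex_of_real (d N / 2)) (canon_basis (int (Suc N))) + t (Suc N)) k"
        by cases (simp_all add: t_def cscale_def canon_basis_def)
    qed
    then show ?case using Suc by (simp only: vN(5) add.assoc)
  qed
  have x: "x \<in> X" unfolding x_def by (intro X_add vN t)
  note K = krylov_subspace[OF T x]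
  let ?M = "seq_top p closure_of (krylov ?T x)"
  have "canon_basis j \<in> ?M" for j
    unfolding mem_closure_seq_top[OF K(2)]
  proof (intro conjI allI impI canon_basis_unit)
    fix e :: real assume "0 < e"
    then obtain N0 where N0: "1 / real (Suc N0) < e" using nat_approx_posE by blast
    define N where "N = max N0 (nat \<bar>j\<bar>)"
    have "x - v N = t N" using xv[of N] by simp
    then have "nrm (x - v N) \<le> d N" using t by simp
    then have "\<forall>y\<in>canon_basis ` {- int N..int N}. \<exists>z\<in>krylov ?T x. nrm (y - z) < 1 / real (Suc N)"
      using vN(2)[of N] x by (auto simp: near_def)
    moreover have "j \<in> {- int N..int N}" by (auto simp: N_def)
    ultimately obtain z where z: "z \<in> krylov ?T x" "nrm (canon_basis j - z) < 1 / real (Suc N)" by blast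
    have "1 / real (Suc N) \<le> 1 / real (Suc N0)" by (intro divide_left_mono) (auto simp: N_def)
    then show "\<exists>z\<in>krylov ?T x. nrm (canon_basis j - z) < e" using z N0 by (intro bexI[of _ z]) auto
  qed
  then have "?M = X" by (rule closed_subspace_with_basis[OF closed_subspace_closure[OF K(1,2)]])
  then show ?thesis unfolding cyclic_op_def krylov_eq_span[OF T x] using T x by blast
qed

end

theorem corollary1p5:
  fixes p :: ereal and w :: "int \<Rightarrow> complex"
  assumes "1 \<le> p"
    and "bounded (range w)"
    and "\<And>n. w n \<noteq> 0"
  shows "(quasinilpotent_op p (weighted_shift w) \<longrightarrow> cyclic_op p (weighted_shift w)) \<and>
         (compact_op p (weighted_shift w) \<longrightarrow> cyclic_op p (weighted_shift w))"
proof (intro conjI impI)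
  assume "quasinilpotent_op p (weighted_shift w)"
  then have T: "bounded_op p (weighted_shift w)" "op_spectrum p (weighted_shift w) \<subseteq> {0}"
    by (auto simp: quasinilpotent_op_def)
  show "cyclic_op p (weighted_shift w)"
    by (rule cyclic_if_absorbs[OF assms quasinilpotent_absorbs[OF assms(1) T]])
next
  assume T: "compact_op p (weighted_shift w)"
  show "cyclic_op p (weighted_shift w)"
    by (rule cyclic_if_absorbs[OF assms compact_shift_absorbs[OF assms(1,2) T]])
qed

end
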